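(* Let $n\in\mathbb{N}$ and $\alpha>-1$. Then $\mathcal{A}_n^2(\mathbb{D},\mu_\alpha)$ is the orthogonal (Hilbert space) direct sum $$\mathcal{A}_n^2(\mathbb{D},\mu_\alpha)=\bigoplus_{\xi=-n+1}^{\infty}\mathcal{W}^{(\alpha)}_{\xi,\min\{n,n+\xi\}}.$$
   Context: $\mathbb{N}=\{1,2,\dots\}$, $\mathbb{N}_0=\{0,1,2,\dots\}$, $\mathbb{D}$ is the open unit disk. The measure $\mu_\alpha$ on $\mathbb{D}$ is $\mathrm{d}\mu_\alpha(z)=\frac{\alpha+1}{\pi}(1-|z|^2)^\alpha\,\mathrm{d}\mu(z)$, where $\mu$ is Lebesgue plane measure. A function $f$ is $n$-analytic if it is smooth and $(\partial/\partial\overline{z})^n f=0$. $\mathcal{A}_n^2(\mathbb{D},\mu_\alpha)$ is the space of $n$-analytic functions on $\mathbb{D}$ that are square-integrable with respect to $\mu_\alpha$, with the inner product of $L^2(\mathbb{D},\mu_\alpha)$. Put $m_{p,q}(z)=z^p\overline{z}^q$ for $p,q\in\mathbb{N}_0$. For $\xi\in\mathbb{Z}$ and $s\in\mathbb{N}$, $$\mathcal{W}^{(\alpha)}_{\xi,s}=\operatorname{span}\{m_{p,q}:\ p,q\in\mathbb{N}_0,\ p-q=\xi,\ \min\{p,q\}<s\},$$ endowed with the inner product of $L^2(\mathbb{D},\mu_\alpha)$. *)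

theory Defs
  imports "HOL-Analysis.Analysis" "HOL-Library.Function_Algebras"
begin

definition fun_scale :: "complex \<Rightarrow> ('a \<Rightarrow> complex) \<Rightarrow> 'a \<Rightarrow> complex"
  where "fun_scale c f = (\<lambda>x. c * f x)"

global_interpretation cfun: vector_space fun_scale
  defines cfun_span = cfun.span and cfun_subspace = cfun.subspace
  by unfold_locales (auto simp: fun_scale_def fun_eq_iff algebra_simps)

definition L2 :: "'a measure \<Rightarrow> ('a \<Rightarrow> complex) set"
  where "L2 M = {f \<in> borel_measurable M. integrable M (\<lambda>x. (cmod (f x))\<^sup>2)}"

definition l2_inner :: "'a measure \<Rightarrow> ('a \<Rightarrow> complex) \<Rightarrow> ('a \<Rightarrow> complex) \<Rightarrow> complex"
  where "l2_inner M f g = (\<integral>x. f x * cnj (g x) \<partial>M)"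

definition l2_norm :: "'a measure \<Rightarrow> ('a \<Rightarrow> complex) \<Rightarrow> real"
  where "l2_norm M f = sqrt (Re (l2_inner M f f))"

(* Elements of L2 M are functions, not classes modulo null sets. The definiteness
   clause makes the semi-inner product of L2 M an inner product on H. *)
definition l2_hilbert_subspace :: "'a measure \<Rightarrow> ('a \<Rightarrow> complex) set \<Rightarrow> bool"
  where "l2_hilbert_subspace M H \<longleftrightarrow>
    H \<subseteq> L2 M \<and> cfun_subspace H \<and>
    (\<forall>f\<in>H. l2_norm M f = 0 \<longrightarrow> f = 0) \<and>
    (\<forall>X :: nat \<Rightarrow> 'a \<Rightarrow> complex.
       range X \<subseteq> H \<and> (\<forall>e>0. \<exists>N. \<forall>i\<ge>N. \<forall>j\<ge>N. l2_norm M (X i - X j) < e) \<longrightarrow>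
       (\<exists>f\<in>H. (\<lambda>k. l2_norm M (X k - f)) \<longlonglongrightarrow> 0))"

definition l2_has_sum ::
    "'a measure \<Rightarrow> ('i \<Rightarrow> 'a \<Rightarrow> complex) \<Rightarrow> ('a \<Rightarrow> complex) \<Rightarrow> 'i set \<Rightarrow> bool"
  where "l2_has_sum M g f I \<longleftrightarrow>
    ((\<lambda>F. l2_norm M ((\<Sum>i\<in>F. g i) - f)) \<longlongrightarrow> 0) (finite_subsets_at_top I)"

(* H is the internal orthogonal Hilbert direct sum of the W i, i in I. Uniqueness of the
   decomposition follows from orthogonality and definiteness, and convergence in H of every
   square-summable family of vectors in the W i follows from completeness of H. *)
definition orthogonal_hilbert_sum ::
    "'a measure \<Rightarrow> ('a \<Rightarrow> complex) set \<Rightarrow> 'i set \<Rightarrow> ('i \<Rightarrow> ('a \<Rightarrow> complex) set) \<Rightarrow> bool"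
  where "orthogonal_hilbert_sum M H I W \<longleftrightarrow>
    l2_hilbert_subspace M H \<and>
    (\<forall>i\<in>I. W i \<subseteq> H \<and> l2_hilbert_subspace M (W i)) \<and>
    (\<forall>i\<in>I. \<forall>j\<in>I. i \<noteq> j \<longrightarrow> (\<forall>f\<in>W i. \<forall>g\<in>W j. l2_inner M f g = 0)) \<and>
    (\<forall>f\<in>H. \<exists>g. (\<forall>i\<in>I. g i \<in> W i) \<and> l2_has_sum M g f I)"

abbreviation unit_disk :: "complex set"
  where "unit_disk \<equiv> ball 0 1"

definition mu :: "real \<Rightarrow> complex measure"
  where "mu \<alpha> = density (restrict_space lborel unit_disk)
    (\<lambda>z. ennreal ((\<alpha> + 1) / pi * (1 - (cmod z)\<^sup>2) powr \<alpha>))"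

(* Real differentiability throughout; S is meant to be open. *)
primrec Ck_on :: "nat \<Rightarrow> (complex \<Rightarrow> complex) \<Rightarrow> complex set \<Rightarrow> bool"
  where
    "Ck_on 0 f S \<longleftrightarrow> continuous_on S f"
  | "Ck_on (Suc k) f S \<longleftrightarrow> (\<forall>z\<in>S. f differentiable (at z)) \<and>
       (\<forall>v. Ck_on k (\<lambda>z. frechet_derivative f (at z) v) S)"

definition smooth_on :: "(complex \<Rightarrow> complex) \<Rightarrow> complex set \<Rightarrow> bool"
  where "smooth_on f S \<longleftrightarrow> (\<forall>k. Ck_on k f S)"

(* The Wirtinger operator (d/dx + i d/dy) / 2. *)
definition dbar :: "(complex \<Rightarrow> complex) \<Rightarrow> complex \<Rightarrow> complex"
  where "dbar f z =
    (frechet_derivative f (at z) 1 + \<i> * frechet_derivative f (at z) \<i>) / 2"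

definition n_analytic_on :: "nat \<Rightarrow> (complex \<Rightarrow> complex) \<Rightarrow> complex set \<Rightarrow> bool"
  where "n_analytic_on n f S \<longleftrightarrow> smooth_on f S \<and> (\<forall>z\<in>S. (dbar ^^ n) f z = 0)"

(* A function on the disk is represented by its extension by 0 to the plane. *)
definition poly_bergman :: "nat \<Rightarrow> real \<Rightarrow> (complex \<Rightarrow> complex) set"
  where "poly_bergman n \<alpha> =
    {f. (\<forall>z. z \<notin> unit_disk \<longrightarrow> f z = 0) \<and> n_analytic_on n f unit_disk \<and> f \<in> L2 (mu \<alpha>)}"

definition mon :: "nat \<Rightarrow> nat \<Rightarrow> complex \<Rightarrow> complex"
  where "mon p q z = (if z \<in> unit_disk then z ^ p * cnj z ^ q else 0)"

(* The underlying vector space does not depend on alpha, only its inner product does. *)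
definition W_space :: "int \<Rightarrow> nat \<Rightarrow> (complex \<Rightarrow> complex) set"
  where "W_space \<xi> s = cfun_span {mon p q | p q. int p - int q = \<xi> \<and> min p q < s}"

end

theory Submission
  imports Defs "HOL-Complex_Analysis.Complex_Analysis"
begin

text \<open>
  Integrating \<open>dbar\<close> successively writes an \<open>n\<close>-analytic function on the disk as
  \<open>f z = (\<Sum>q<n. cnj z ^ q * h\<^sub>q z)\<close> with holomorphic \<open>h\<^sub>q\<close>. Expanding each \<open>h\<^sub>q\<close> in powers
  of \<open>z\<close> and collecting the monomials \<open>m\<^sub>p\<^sub>,\<^sub>q\<close> with \<open>p - q = \<xi>\<close> gives components \<open>f\<^sub>\<xi>\<close> in the
  spaces \<open>W\<close>, pairwise orthogonal because the measure is invariant under rotations. On a smaller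
  disk \<open>|z| < r\<close> the expansion is bounded, so Bessel's inequality follows there by dominated
  convergence, and on the whole disk by letting \<open>r\<close> tend to 1. Fatou's lemma then bounds
  the square of the norm of the remainder by the tail of the series of the squared norms of the
  \<open>f\<^sub>\<xi>\<close>.

  For completeness, the coefficients satisfy \<open>|a\<^sub>p\<^sub>,\<^sub>q| \<rho> ^ p \<le> C \<parallel>f\<parallel>\<close> with \<open>C\<close> depending only on
  \<open>n\<close>, \<open>\<alpha>\<close> and \<open>\<rho> < 1\<close>: up to a power of \<open>|z|\<close>, the modulus of \<open>f\<^sub>\<xi>\<close> is that of a polynomial
  in \<open>|z|\<^sup>2\<close> of degree below \<open>n\<close>, which is determined by its values at \<open>n\<close> points, and
  these can be chosen in \<open>n\<close> fixed small balls so that the values are controlled by the norm. Hence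
  the coefficients of a Cauchy sequence converge, and they define its limit.
\<close>

section \<open>The measure on the disk\<close>

lemma lborel_complex_eq_distr:
  "distr (lborel \<Otimes>\<^sub>M lborel) borel (\<lambda>(x, y). Complex x y) = lborel"
proof (rule lborel_eqI [symmetric])
  have [measurable]: "(\<lambda>(x, y). Complex x y) \<in> borel_measurable (lborel \<Otimes>\<^sub>M lborel)"
    unfolding lborel_prod
    by (auto simp: case_prod_beta Complex_eq intro!: borel_measurable_continuous_onI continuous_intros)
  fix l u :: complex
  assume le: "\<And>b. b \<in> Basis \<Longrightarrow> l \<bullet> b \<le> u \<bullet> b"
  from le[of 1] le[of \<i>] have "Re l \<le> Re u" "Im l \<le> Im u"
    by (auto simp: Basis_complex_def)
  moreover have "(\<lambda>(x, y). Complex x y) -` box l u \<inter> space (lborel \<Otimes>\<^sub>M lborel) =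
      {Re l<..<Re u} \<times> {Im l<..<Im u}"
    by (auto simp: box_def Basis_complex_def space_pair_measure)
  ultimately show "emeasure (distr (lborel \<Otimes>\<^sub>M lborel) borel (\<lambda>(x, y). Complex x y)) (box l u) =
      ennreal (\<Prod>b\<in>Basis. (u - l) \<bullet> b)"
    by (simp add: emeasure_distr lborel.emeasure_pair_measure_Times Basis_complex_def
        ennreal_mult)
qed simp

text \<open>Tonelli's theorem in both orders: a shear along one axis becomes a translation once the
  inner variable runs along that axis.\<close>

lemma nn_integral_lborel_complex:
  assumes [measurable]: "F \<in> borel_measurable borel"
  shows "integral\<^sup>N lborel F = (\<integral>\<^sup>+y. \<integral>\<^sup>+x. F (Complex x y) \<partial>lborel \<partial>lborel)"
    and "integral\<^sup>N lborel F = (\<integral>\<^sup>+x. \<integral>\<^sup>+y. F (Complex x y) \<partial>lborel \<partial>lborel)"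
proof -
  have [measurable]: "(\<lambda>(x, y). Complex x y) \<in> borel_measurable (lborel \<Otimes>\<^sub>M lborel)"
    unfolding lborel_prod
    by (auto simp: case_prod_beta Complex_eq intro!: borel_measurable_continuous_onI continuous_intros)
  have eq: "integral\<^sup>N lborel F = (\<integral>\<^sup>+(x, y). F (Complex x y) \<partial>(lborel \<Otimes>\<^sub>M lborel))"
    by (subst lborel_complex_eq_distr [symmetric], subst nn_integral_distr) (simp_all add: case_prod_beta')
  have "(\<lambda>p. F (case p of (x, y) \<Rightarrow> Complex x y)) \<in> borel_measurable (lborel \<Otimes>\<^sub>M lborel)"
    by measurable
  then have "(\<lambda>(x, y). F (Complex x y)) \<in> borel_measurable (lborel \<Otimes>\<^sub>M lborel)"
    by (simp add: case_prod_beta)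
  from lborel_pair.nn_integral_snd[OF this] lborel.nn_integral_fst[OF this]
  show "integral\<^sup>N lborel F = (\<integral>\<^sup>+y. \<integral>\<^sup>+x. F (Complex x y) \<partial>lborel \<partial>lborel)"
    "integral\<^sup>N lborel F = (\<integral>\<^sup>+x. \<integral>\<^sup>+y. F (Complex x y) \<partial>lborel \<partial>lborel)"
    by (simp_all add: eq)
qed

lemma nn_integral_lborel_translate:
  fixes c :: real
  assumes [measurable]: "F \<in> borel_measurable borel"
  shows "(\<integral>\<^sup>+x. F (x + c) \<partial>lborel) = integral\<^sup>N lborel F"
proof -
  have "integral\<^sup>N lborel F = integral\<^sup>N (distr lborel borel ((+) c)) F"
    by (simp add: lborel_distr_plus)
  also have "\<dots> = (\<integral>\<^sup>+x. F (x + c) \<partial>lborel)"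
    by (subst nn_integral_distr) (simp_all add: add.commute)
  finally show ?thesis by simp
qed

lemma measurable_Complex_Re_Im [measurable]:
  assumes [measurable]: "f \<in> borel_measurable M" "g \<in> borel_measurable M"
  shows "(\<lambda>z. Complex (f z) (g z)) \<in> borel_measurable M"
  unfolding Complex_eq by measurable

lemma nn_integral_shear_Re:
  assumes [measurable]: "F \<in> borel_measurable borel"
  shows "(\<integral>\<^sup>+z. F (Complex (Re z + c * Im z) (Im z)) \<partial>lborel) = integral\<^sup>N lborel F"
proof -
  have "(\<integral>\<^sup>+x. F (Complex (x + c * y) y) \<partial>lborel) = (\<integral>\<^sup>+x. F (Complex x y) \<partial>lborel)" for y
    by (rule nn_integral_lborel_translate[where F = "\<lambda>x. F (Complex x y)"]) measurable
  then show ?thesis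
    by (simp add: nn_integral_lborel_complex(1))
qed

lemma nn_integral_shear_Im:
  assumes [measurable]: "F \<in> borel_measurable borel"
  shows "(\<integral>\<^sup>+z. F (Complex (Re z) (Im z + c * Re z)) \<partial>lborel) = integral\<^sup>N lborel F"
proof -
  have "(\<integral>\<^sup>+y. F (Complex x (y + c * x)) \<partial>lborel) = (\<integral>\<^sup>+y. F (Complex x y) \<partial>lborel)" for x
    by (rule nn_integral_lborel_translate[where F = "\<lambda>y. F (Complex x y)"]) measurable
  then show ?thesis
    by (simp add: nn_integral_lborel_complex(2))
qed

text \<open>A rotation other than \<open>-1\<close> is a product of three shears.\<close>
lemma nn_integral_rotation:
  assumes [measurable]: "F \<in> borel_measurable borel" and u: "cmod u = 1" "u \<noteq> -1"
  shows "(\<integral>\<^sup>+z. F (u * z) \<partial>lborel) = integral\<^sup>N lborel F"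
proof -
  \<comment> \<open>For \<open>u = cis \<theta>\<close> this is \<open>- tan (\<theta> / 2)\<close>.
    The shears have parameters \<open>t\<close>, \<open>Im u\<close>, \<open>t\<close>, and the
    denominator vanishes only at \<open>u = -1\<close>.\<close>
  define t where "t = - Im u / (1 + Re u)"
  have sq: "(Re u)\<^sup>2 + (Im u)\<^sup>2 = 1"
    using u(1) by (simp add: cmod_def)
  have nz: "1 + Re u \<noteq> 0"
  proof
    assume "1 + Re u = 0"
    then have "Re u = -1" by simp
    with sq show False using u(2) by (auto simp: complex_eq_iff)
  qed
  have Im_t: "Im u * t = Re u - 1"
    using sq nz by (simp add: t_def field_simps power2_eq_square)
  have t_Re: "t + t * Re u = - Im u"
  proof -
    have "t * (1 + Re u) = - Im u"
      using nz by (simp add: t_def)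
    then show ?thesis by (simp add: algebra_simps)
  qed
  have rot: "u * z = (let z1 = Complex (Re z + t * Im z) (Im z);
          z2 = Complex (Re z1) (Im z1 + Im u * Re z1)
        in Complex (Re z2 + t * Im z2) (Im z2))" for z
  proof -
    \<comment> \<open>The left side is the upper right entry of the matrix of the composed
      shears.\<close>
    have "t + t * (Im u * t) + t = - Im u"
      using t_Re unfolding Im_t by (simp add: algebra_simps)
    then have "Re z * (Im u * t) + Im z * (t + t * (Im u * t) + t) = Re z * (Re u - 1) - Im z * Im u"
      unfolding Im_t by simp
    moreover have "Im z * (Im u * t) = Im z * (Re u - 1)"
      unfolding Im_t ..
    ultimately show ?thesis
      by (simp add: complex_eq_iff Let_def algebra_simps)
  qed
  have "integral\<^sup>N lborel F = (\<integral>\<^sup>+z. F (Complex (Re z + t * Im z) (Im z)) \<partial>lborel)"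
    by (rule nn_integral_shear_Re[symmetric]) measurable
  also have "\<dots> = (\<integral>\<^sup>+z. (\<lambda>z. F (Complex (Re z + t * Im z) (Im z)))
      (Complex (Re z) (Im z + Im u * Re z)) \<partial>lborel)"
    by (rule nn_integral_shear_Im[symmetric]) measurable
  also have "\<dots> = (\<integral>\<^sup>+z. (\<lambda>z. (\<lambda>z. F (Complex (Re z + t * Im z) (Im z)))
      (Complex (Re z) (Im z + Im u * Re z))) (Complex (Re z + t * Im z) (Im z)) \<partial>lborel)"
    by (rule nn_integral_shear_Re[symmetric]) measurable
  also have "\<dots> = (\<integral>\<^sup>+z. F (u * z) \<partial>lborel)"
    by (simp add: rot Let_def)
  finally show ?thesis by simp
qed

text \<open>For \<open>0 \<le> x < 1\<close> the points of the disk with 1 - |z|^2 > x form a disk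
  of radius \<open>sqrt (1 - x)\<close>, so their area \<open>pi * (1 - x)\<close> is linear in
  \<open>x\<close>. This turns radial integrals into integrals over (0, 1), and measures on the line
  are determined by such half-lines.\<close>

lemma distr_disk_uniform:
  "distr (density lborel (indicator (ball 0 1))) borel (\<lambda>z::complex. 1 - (cmod z)\<^sup>2) =
   density lborel (\<lambda>t. ennreal pi * indicator {0<..<1} t)" (is "?M = ?N")
proof (rule measure_eqI_lessThan)
  have vol: "emeasure lborel (ball (0::complex) r) = ennreal (pi * r\<^sup>2)" if "r \<ge> 0" for r
    using that by (simp add: emeasure_ball unit_ball_vol_2)
  have M: "emeasure ?M {x<..} = emeasure lborel {z::complex. cmod z < 1 \<and> (cmod z)\<^sup>2 < 1 - x}" for x
  proof -
    have "emeasure ?M {x<..} = emeasure (density lborel (indicator unit_disk)) {z. x < 1 - (cmod z)\<^sup>2}"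
      by (simp add: emeasure_distr vimage_def)
    also have "\<dots> = emeasure lborel (ball 0 1 \<inter> {z::complex. x < 1 - (cmod z)\<^sup>2})"
      by (subst emeasure_density)
        (simp_all add: borel_measurable_indicator flip: indicator_inter_arith)
    also have "ball 0 1 \<inter> {z. x < 1 - (cmod z)\<^sup>2} = {z::complex. cmod z < 1 \<and> (cmod z)\<^sup>2 < 1 - x}"
      by auto
    finally show ?thesis .
  qed
  have N: "emeasure ?N {x<..} = ennreal pi * emeasure lborel ({0<..<1} \<inter> {x<..})" for x
    by (simp add: emeasure_density mult.assoc nn_integral_cmult flip: indicator_inter_arith)
  fix x :: real
  consider "x < 0" | "0 \<le> x" "x < 1" | "1 \<le> x" by linarith
  then show eq: "emeasure ?M {x<..} = emeasure ?N {x<..}"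
  proof cases
    case 1
    have "(cmod z)\<^sup>2 < 1 - x" if "cmod z < 1" for z
      using power_strict_mono[OF that, of 2] 1 by simp
    then have "{z::complex. cmod z < 1 \<and> (cmod z)\<^sup>2 < 1 - x} = ball 0 1" by auto
    moreover have "{0<..<1} \<inter> {x<..} = {0<..<1}" using 1 by auto
    ultimately show ?thesis unfolding M N using vol[of 1] by simp
  next
    case 2
    have "(cmod z < 1 \<and> (cmod z)\<^sup>2 < 1 - x) \<longleftrightarrow> cmod z < sqrt (1 - x)" for z
    proof -
      have "(cmod z)\<^sup>2 < 1 - x \<longleftrightarrow> cmod z < sqrt (1 - x)"
        using real_sqrt_less_iff[of "(cmod z)\<^sup>2" "1 - x"] by simp
      moreover have "sqrt (1 - x) \<le> 1" using 2 by simp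
      ultimately show ?thesis by (meson less_le_trans)
    qed
    then have "{z::complex. cmod z < 1 \<and> (cmod z)\<^sup>2 < 1 - x} = ball 0 (sqrt (1 - x))" by auto
    moreover have "{0<..<1} \<inter> {x<..} = {x<..<1}" using 2 by auto
    ultimately show ?thesis unfolding M N using vol[of "sqrt (1 - x)"] 2
      by (simp add: ennreal_mult)
  next
    case 3
    have "\<not> (cmod z)\<^sup>2 < 1 - x" for z
      using 3 by (smt (verit) zero_le_power2)
    then have "{z::complex. cmod z < 1 \<and> (cmod z)\<^sup>2 < 1 - x} = {}" by simp
    moreover have "{0<..<1} \<inter> {x<..} = {}" using 3 by auto
    ultimately show ?thesis unfolding M N by (simp only: emeasure_empty mult_zero_right)
  qed
  have "emeasure ?N {x<..} \<le> ennreal pi * emeasure lborel {0<..<1::real}"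
    unfolding N by (intro mult_left_mono emeasure_mono) auto
  also have "\<dots> < \<infinity>" by simp
  finally show "emeasure ?M {x<..} < \<infinity>" using eq by simp
qed simp_all

section \<open>The weighted measure: finiteness, rotation invariance, open sets\<close>

lemma space_mu [simp]: "space (mu \<alpha>) = unit_disk"
  by (simp add: mu_def space_restrict_space)

lemma sets_mu: "sets (mu \<alpha>) = sets (restrict_space borel unit_disk)"
  by (simp add: mu_def sets_restrict_space)

lemma in_sets_mu_iff: "A \<in> sets (mu \<alpha>) \<longleftrightarrow> A \<in> sets borel \<and> A \<subseteq> unit_disk"
  by (auto simp: sets_mu sets_restrict_space_iff)

lemma emeasure_mu:
  assumes "A \<in> sets (mu \<alpha>)"
  shows "emeasure (mu \<alpha>) A =
    (\<integral>\<^sup>+z. ennreal ((\<alpha> + 1) / pi * (1 - (cmod z)\<^sup>2) powr \<alpha>) * indicator A z \<partial>lborel)"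
proof -
  have A: "A \<subseteq> unit_disk" "A \<in> sets (restrict_space lborel unit_disk)"
    using assms by (auto simp: in_sets_mu_iff sets_restrict_space_iff)
  have "emeasure (mu \<alpha>) A = (\<integral>\<^sup>+z. ennreal ((\<alpha> + 1) / pi * (1 - (cmod z)\<^sup>2) powr \<alpha>) * indicator A z
      \<partial>restrict_space lborel unit_disk)"
    unfolding mu_def using A(2)
    by (subst emeasure_density) (auto intro!: measurable_restrict_space1)
  also have "\<dots> = (\<integral>\<^sup>+z. ennreal ((\<alpha> + 1) / pi * (1 - (cmod z)\<^sup>2) powr \<alpha>) * indicator A z *
      indicator unit_disk z \<partial>lborel)"
    by (subst nn_integral_restrict_space) simp_all
  also have "\<dots> = (\<integral>\<^sup>+z. ennreal ((\<alpha> + 1) / pi * (1 - (cmod z)\<^sup>2) powr \<alpha>) * indicator A z \<partial>lborel)"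
    using A(1) by (intro nn_integral_cong) (auto simp: indicator_def)
  finally show ?thesis .
qed

lemma finite_measure_mu:
  assumes "\<alpha> > -1"
  shows "finite_measure (mu \<alpha>)"
proof (rule finite_measureI)
  let ?c = "(\<alpha> + 1) / pi"
  have "emeasure (mu \<alpha>) (space (mu \<alpha>)) =
      (\<integral>\<^sup>+z. ennreal (?c * (1 - (cmod z)\<^sup>2) powr \<alpha>) * indicator unit_disk z \<partial>lborel)"
    by (subst emeasure_mu) (simp_all add: in_sets_mu_iff)
  also have "\<dots> = (\<integral>\<^sup>+z. ennreal (?c * (1 - (cmod z)\<^sup>2) powr \<alpha>)
      \<partial>density lborel (indicator unit_disk))"
    by (subst nn_integral_density) (simp_all add: mult.commute borel_measurable_indicator)
  \<comment> \<open>Substituting t = 1 - |z|^2 leaves a power of \<open>t\<close>, integrable at 0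
    because \<open>\<alpha> > -1\<close>.\<close>
  also have "\<dots> = (\<integral>\<^sup>+t. ennreal (?c * t powr \<alpha>)
      \<partial>distr (density lborel (indicator unit_disk)) borel (\<lambda>z. 1 - (cmod z)\<^sup>2))"
    by (subst nn_integral_distr) simp_all
  also have "\<dots> = (\<integral>\<^sup>+t. ennreal pi * indicator {0<..<1} t * ennreal (?c * t powr \<alpha>) \<partial>lborel)"
    unfolding distr_disk_uniform by (subst nn_integral_density) simp_all
  also have "\<dots> \<le> (\<integral>\<^sup>+t. ennreal ((\<alpha> + 1) * (if t \<in> {0..1} then t powr \<alpha> else 0)) \<partial>lborel)"
    using assms by (intro nn_integral_mono) (auto simp: indicator_def simp flip: ennreal_mult)
  also have "\<dots> = ennreal ((\<alpha> + 1) * (1 powr (\<alpha> + 1) / (\<alpha> + 1)))"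
  proof (rule nn_integral_has_integral_lborel)
    show "((\<lambda>t. (\<alpha> + 1) * (if t \<in> {0..1} then t powr \<alpha> else 0)) has_integral
        (\<alpha> + 1) * (1 powr (\<alpha> + 1) / (\<alpha> + 1))) UNIV"
      using has_integral_powr_from_0[OF assms, of 1]
      by (intro has_integral_mult_right) (simp only: has_integral_restrict_UNIV)
  qed (use assms in auto)
  also have "\<dots> < \<infinity>" by simp
  finally show "emeasure (mu \<alpha>) (space (mu \<alpha>)) \<noteq> \<infinity>" by simp
qed

lemma measurable_rotation_mu:
  assumes "cmod u = 1"
  shows "(*) u \<in> measurable (mu \<alpha>) (mu \<alpha>)"
proof -
  have "(*) u \<in> measurable (restrict_space borel unit_disk) (restrict_space borel unit_disk)"
    using assms by (intro measurable_restrict_space3) (auto simp: norm_mult)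
  then show ?thesis
    by (simp cong: measurable_cong_sets add: sets_mu)
qed

text \<open>The density depends on |z| only, so the rotation invariance of Lebesgue measure carries
  over; \<open>-1\<close> is excluded as in the decomposition into shears.\<close>

lemma distr_rotation_mu:
  assumes u: "cmod u = 1" "u \<noteq> -1"
  shows "distr (mu \<alpha>) (mu \<alpha>) ((*) u) = mu \<alpha>"
proof (rule measure_eqI)
  fix A assume "A \<in> sets (distr (mu \<alpha>) (mu \<alpha>) ((*) u))"
  then have A: "A \<in> sets (mu \<alpha>)" by simp
  then have [measurable]: "A \<in> sets borel" and sub: "A \<subseteq> unit_disk" by (auto simp: in_sets_mu_iff)
  define w where "w = (\<lambda>z. ennreal ((\<alpha> + 1) / pi * (1 - (cmod z)\<^sup>2) powr \<alpha>))"
  have [measurable]: "w \<in> borel_measurable borel" unfolding w_def by measurable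
  have "emeasure (distr (mu \<alpha>) (mu \<alpha>) ((*) u)) A = emeasure (mu \<alpha>) ((*) u -` A \<inter> unit_disk)"
    using A measurable_rotation_mu[OF u(1)] by (simp add: emeasure_distr)
  also have "\<dots> = (\<integral>\<^sup>+z. w z * indicator ((*) u -` A \<inter> unit_disk) z \<partial>lborel)"
    using measurable_sets[OF measurable_rotation_mu[OF u(1)] A] by (simp add: emeasure_mu w_def)
  also have "\<dots> = (\<integral>\<^sup>+z. (\<lambda>z. w z * indicator A z) (u * z) \<partial>lborel)"
    using sub u by (intro nn_integral_cong) (auto simp: w_def norm_mult indicator_def subset_iff)
  also have "\<dots> = (\<integral>\<^sup>+z. w z * indicator A z \<partial>lborel)"
    using u by (intro nn_integral_rotation) measurable
  also have "\<dots> = emeasure (mu \<alpha>) A"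
    using A by (simp add: emeasure_mu w_def)
  finally show "emeasure (distr (mu \<alpha>) (mu \<alpha>) ((*) u)) A = emeasure (mu \<alpha>) A" .
qed simp

lemma integral_rotation_mu:
  fixes f :: "complex \<Rightarrow> complex"
  assumes "f \<in> borel_measurable (mu \<alpha>)" "cmod u = 1" "u \<noteq> -1"
  shows "(\<integral>z. f (u * z) \<partial>mu \<alpha>) = (\<integral>z. f z \<partial>mu \<alpha>)"
  using integral_distr[OF measurable_rotation_mu[OF assms(2)] assms(1)]
  by (simp add: distr_rotation_mu assms)

text \<open>The density is positive on the disk and a nonempty open set is not negligible. This
  underlies both definiteness of the norm and control of values by the norm.\<close>

lemma measure_mu_pos:
  assumes "\<alpha> > -1" "open U" "U \<noteq> {}" "U \<subseteq> unit_disk"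
  shows "measure (mu \<alpha>) U > 0"
proof -
  interpret finite_measure "mu \<alpha>" by (rule finite_measure_mu) fact
  have [measurable]: "U \<in> sets borel" using assms by simp
  have U: "U \<in> sets (mu \<alpha>)" using assms by (simp add: in_sets_mu_iff)
  have "emeasure (mu \<alpha>) U \<noteq> 0"
  proof
    assume "emeasure (mu \<alpha>) U = 0"
    then have "AE z in lborel. ennreal ((\<alpha> + 1) / pi * (1 - (cmod z)\<^sup>2) powr \<alpha>) * indicator U z = 0"
      unfolding emeasure_mu[OF U] by (subst (asm) nn_integral_0_iff_AE) measurable
    moreover have "ennreal ((\<alpha> + 1) / pi * (1 - (cmod z)\<^sup>2) powr \<alpha>) * indicator U z \<noteq> 0"
      if "z \<in> U" for z
    proof -
      have "cmod z < 1" using that assms(4) by auto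
      then have "(cmod z)\<^sup>2 < 1" by (simp add: power_less_one_iff)
      then show ?thesis using that assms(1) by simp
    qed
    ultimately have "AE z in lborel. z \<notin> U"
      by (auto elim!: eventually_mono)
    then have "U \<in> null_sets lborel"
      by (subst AE_iff_null_sets) auto
    then show False
      using assms(2,3) open_not_negligible by (auto simp: negligible_iff_null_sets intro: null_sets_completionI)
  qed
  then show ?thesis
    by (simp add: emeasure_eq_measure zero_less_measure_iff)
qed

section \<open>Polyanalytic functions as polynomials in the conjugate variable\<close>

definition polyanalytic_expansion ::
    "nat \<Rightarrow> (nat \<Rightarrow> complex \<Rightarrow> complex) \<Rightarrow> (complex \<Rightarrow> complex) \<Rightarrow> complex set \<Rightarrow> bool"
  where "polyanalytic_expansion n h f S \<longleftrightarrow>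
    (\<forall>q<n. h q holomorphic_on S) \<and> (\<forall>z\<in>S. f z = (\<Sum>q<n. cnj z ^ q * h q z))"

text \<open>\<open>frechet_derivative\<close> is a choice from the predicate
  \<open>has_derivative\<close>. The predicates for \<open>f\<close> and \<open>g\<close> coincide,
  hence so do the choices, even at a point where neither function is differentiable.\<close>

lemma frechet_derivative_cong_open:
  assumes "open S" "z \<in> S" "\<And>w. w \<in> S \<Longrightarrow> f w = g w"
  shows "frechet_derivative f (at z) = frechet_derivative g (at z)"
proof -
  have "(f has_derivative f') (at z) \<longleftrightarrow> (g has_derivative f') (at z)" for f'
    using has_derivative_transform_within_open[OF _ assms(1,2), where f = f and f' = f' and g = g]
      has_derivative_transform_within_open[OF _ assms(1,2), where f = g and f' = f' and g = f] assms(3) by auto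
  then show ?thesis
    by (simp add: frechet_derivative_def)
qed

lemma Ck_on_cong:
  assumes "open S" "\<And>w. w \<in> S \<Longrightarrow> f w = g w" "Ck_on k f S"
  shows "Ck_on k g S"
  using assms(2,3)
proof (induction k arbitrary: f g)
  case 0
  then show ?case by (simp cong: continuous_on_cong)
next
  case (Suc k)
  have fg: "frechet_derivative f (at z) = frechet_derivative g (at z)" if "z \<in> S" for z
    using frechet_derivative_cong_open[OF assms(1) that] Suc.prems(1) by blast
  have "g differentiable (at z)" if z: "z \<in> S" for z
  proof -
    obtain D where "(f has_derivative D) (at z)"
      using Suc.prems(2) z by (auto simp: differentiable_def)
    then have "(g has_derivative D) (at z)"
      using has_derivative_transform_within_open[OF _ assms(1) z] Suc.prems(1) by blast
    then show ?thesis by (auto simp: differentiable_def)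
  qed
  moreover have "Ck_on k (\<lambda>z. frechet_derivative g (at z) v) S" for v
  proof (rule Suc.IH)
    show "Ck_on k (\<lambda>z. frechet_derivative f (at z) v) S"
      using Suc.prems(2) by simp
  qed (simp only: fg)
  ultimately show ?case by simp
qed

lemma Ck_on_add_cmult:
  assumes "open S" "Ck_on k f S" "Ck_on k g S"
  shows "Ck_on k (\<lambda>z. c * f z + d * g z) S"
  using assms(2,3)
proof (induction k arbitrary: f g)
  case 0
  then show ?case by (auto intro!: continuous_intros)
next
  case (Suc k)
  have der: "((\<lambda>z. c * f z + d * g z) has_derivative
      (\<lambda>v. c * frechet_derivative f (at z) v + d * frechet_derivative g (at z) v)) (at z)"
    if "z \<in> S" for z
    using Suc.prems that
    by (intro derivative_intros) (simp_all add: frechet_derivative_works[symmetric])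
  have "Ck_on k (\<lambda>z. frechet_derivative (\<lambda>z. c * f z + d * g z) (at z) v) S" for v
  proof (rule Ck_on_cong[OF assms(1)])
    show "Ck_on k (\<lambda>z. c * frechet_derivative f (at z) v + d * frechet_derivative g (at z) v) S"
      using Suc.prems by (intro Suc.IH) auto
  qed (simp add: frechet_derivative_at[OF der, symmetric])
  then show ?case
    using der by (auto simp: differentiable_def)
qed

text \<open>Product rule, sorted into a part in \<open>cnj v\<close> and a part in \<open>v\<close>.
  The truncated exponent \<open>q - 1\<close> is harmless at \<open>q = 0\<close> because of the
  factor \<open>of_nat q\<close>.\<close>

lemma polyanalytic_expansion_has_derivative:
  assumes "open S" "polyanalytic_expansion n h f S" "z \<in> S"
  shows "(f has_derivative (\<lambda>v. \<Sum>q<n. of_nat q * cnj z ^ (q - 1) * h q z * cnj v +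
    cnj z ^ q * deriv (h q) z * v)) (at z)"
proof (rule has_derivative_transform_within_open[OF _ assms(1,3)])
  have "(h q has_derivative (\<lambda>v. deriv (h q) z * v)) (at z)" if "q < n" for q
    using assms that holomorphic_derivI unfolding polyanalytic_expansion_def has_field_derivative_def
    by blast
  then show "((\<lambda>z. \<Sum>q<n. cnj z ^ q * h q z) has_derivative
      (\<lambda>v. \<Sum>q<n. of_nat q * cnj z ^ (q - 1) * h q z * cnj v + cnj z ^ q * deriv (h q) z * v)) (at z)"
    by (auto intro!: derivative_eq_intros sum.cong simp: algebra_simps)
qed (use assms in \<open>auto simp: polyanalytic_expansion_def\<close>)

lemma polyanalytic_expansion_dbar:
  assumes "open S" "polyanalytic_expansion n h f S" "z \<in> S"
  shows "dbar f z = (\<Sum>q<n. of_nat q * cnj z ^ (q - 1) * h q z)"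
proof -
  \<comment> \<open>In the directions 1 and \<open>\<i>\<close> the holomorphic parts cancel, while
    the parts in \<open>cnj v\<close> double because \<open>cnj \<i> = - \<i>\<close>.\<close>
  have "dbar f z = ((\<Sum>q<n. of_nat q * cnj z ^ (q - 1) * h q z + cnj z ^ q * deriv (h q) z) +
      \<i> * (\<Sum>q<n. of_nat q * cnj z ^ (q - 1) * h q z * - \<i> + cnj z ^ q * deriv (h q) z * \<i>)) / 2"
    using polyanalytic_expansion_has_derivative[OF assms]
    by (simp add: dbar_def frechet_derivative_at[symmetric])
  also have "\<dots> = (\<Sum>q<n. of_nat q * cnj z ^ (q - 1) * h q z)"
    by (simp add: sum_distrib_left sum.distrib[symmetric] sum_divide_distrib algebra_simps)
  finally show ?thesis .
qed

text \<open>Every directional derivative of an expansion is again an expansion of the same length,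
  so the induction on \<open>k\<close> closes if \<open>f\<close> and \<open>h\<close> are
  arbitrary.\<close>

lemma polyanalytic_expansion_Ck_on:
  assumes "open S" "polyanalytic_expansion n h f S"
  shows "Ck_on k f S"
  using assms(2)
proof (induction k arbitrary: f h)
  case 0
  then have "continuous_on S (h q)" if "q < n" for q
    using that by (auto simp: polyanalytic_expansion_def intro: holomorphic_on_imp_continuous_on)
  then have "continuous_on S (\<lambda>z. \<Sum>q<n. cnj z ^ q * h q z)"
    by (auto intro!: continuous_intros)
  with 0 show ?case
    by (simp add: polyanalytic_expansion_def cong: continuous_on_cong)
next
  case (Suc k)
  note der = polyanalytic_expansion_has_derivative[OF assms(1) Suc.prems]
  have "Ck_on k (\<lambda>z. frechet_derivative f (at z) v) S" for v
  proof (rule Suc.IH)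
    \<comment> \<open>The derivative of the power of \<open>cnj z\<close> lowers its exponent, so
      coefficient \<open>q\<close> also receives a term from \<open>h (Suc q)\<close>; the top
      coefficient receives none.\<close>
    define h' where "h' = (\<lambda>q z. deriv (h q) z * v +
      (if Suc q < n then of_nat (Suc q) * cnj v * h (Suc q) z else 0))"
    have "frechet_derivative f (at z) v = (\<Sum>q<n. cnj z ^ q * h' q z)" if "z \<in> S" for z
    proof -
      have "(\<Sum>q<n. of_nat q * cnj z ^ (q - 1) * h q z * cnj v) =
          (\<Sum>q<n. cnj z ^ q * (if Suc q < n then of_nat (Suc q) * cnj v * h (Suc q) z else 0))"
      proof (cases n)
        case (Suc m)
        have "(\<Sum>q<n. of_nat q * cnj z ^ (q - 1) * h q z * cnj v) =
            (\<Sum>q<m. cnj z ^ q * (of_nat (Suc q) * cnj v * h (Suc q) z))"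
          unfolding Suc by (subst sum.lessThan_Suc_shift) (simp add: algebra_simps)
        then show ?thesis by (simp add: Suc)
      qed simp
      then show ?thesis
        by (simp add: frechet_derivative_at[OF der[OF that], symmetric] h'_def sum.distrib
            algebra_simps)
    qed
    moreover have "h' q holomorphic_on S" if "q < n" for q
      using Suc.prems that assms(1) unfolding h'_def polyanalytic_expansion_def
      by (cases "Suc q < n") (auto intro!: holomorphic_intros)
    ultimately show "polyanalytic_expansion n h' (\<lambda>z. frechet_derivative f (at z) v) S"
      by (simp add: polyanalytic_expansion_def)
  qed
  then show ?case
    using der by (auto simp: differentiable_def)
qed

text \<open>Each application of \<open>dbar\<close> shortens the expansion by one, its new
  coefficient \<open>q\<close> being \<open>Suc q\<close> times the old \<open>h (Suc q)\<close>.
  After \<open>n\<close> applications the sum is empty.\<close>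

lemma polyanalytic_expansion_imp_n_analytic:
  assumes "open S" "polyanalytic_expansion n h f S"
  shows "n_analytic_on n f S"
proof -
  have "\<forall>z\<in>S. (dbar ^^ n) f z = 0"
    using assms(2)
  proof (induction n arbitrary: f h)
    case 0
    then show ?case by (simp add: polyanalytic_expansion_def)
  next
    case (Suc n)
    have "polyanalytic_expansion n (\<lambda>q z. of_nat (Suc q) * h (Suc q) z) (dbar f) S"
      unfolding polyanalytic_expansion_def
    proof (intro conjI allI impI ballI)
      fix z assume "z \<in> S"
      then show "dbar f z = (\<Sum>q<n. cnj z ^ q * (of_nat (Suc q) * h (Suc q) z))"
        unfolding polyanalytic_expansion_dbar[OF assms(1) Suc.prems \<open>z \<in> S\<close>]
        by (subst sum.lessThan_Suc_shift) (simp add: algebra_simps)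
    next
      fix q assume "q < n"
      then show "(\<lambda>z. of_nat (Suc q) * h (Suc q) z) holomorphic_on S"
        using Suc.prems unfolding polyanalytic_expansion_def by (auto intro!: holomorphic_intros)
    qed
    from Suc.IH[OF this] show ?case
      by (simp add: funpow_swap1)
  qed
  then show ?thesis
    using polyanalytic_expansion_Ck_on[OF assms] by (simp add: n_analytic_on_def smooth_on_def)
qed

lemma dbar_eq_0_imp_holomorphic:
  assumes "open S" "\<And>z. z \<in> S \<Longrightarrow> f differentiable (at z)" "\<And>z. z \<in> S \<Longrightarrow> dbar f z = 0"
  shows "f holomorphic_on S"
proof (rule holomorphic_onI)
  fix z assume z: "z \<in> S"
  define A where "A = frechet_derivative f (at z)"
  have der: "(f has_derivative A) (at z)"
    unfolding A_def using assms(2)[OF z] by (simp add: frechet_derivative_works[symmetric])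
  have "A 1 + \<i> * A \<i> = 0"
    using assms(3)[OF z] by (simp add: dbar_def A_def)
  \<comment> \<open>The Cauchy-Riemann equation, solved for \<open>A \<i>\<close>, makes the
    real-linear map \<open>A\<close> complex-linear.\<close>
  then have "\<i> * (A 1 + \<i> * A \<i>) = 0" by simp
  then have Ai: "A \<i> = \<i> * A 1"
    by (simp add: algebra_simps)
  have lin: "linear A"
    using der has_derivative_linear by blast
  have "A v = A 1 * v" for v
  proof -
    have "v = Re v *\<^sub>R 1 + Im v *\<^sub>R \<i>"
      by (simp add: complex_eq_iff)
    then have "A v = A (Re v *\<^sub>R 1 + Im v *\<^sub>R \<i>)"
      by (rule arg_cong)
    also have "\<dots> = Re v *\<^sub>R A 1 + Im v *\<^sub>R A \<i>"
      using lin by (simp add: linear_add linear_scale)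
    also have "\<dots> = A 1 * (of_real (Re v) + \<i> * of_real (Im v))"
      by (simp add: Ai scaleR_conv_of_real algebra_simps)
    also have "of_real (Re v) + \<i> * of_real (Im v) = v"
      by (simp add: complex_eq_iff)
    finally show ?thesis .
  qed
  then have "A = (*) (A 1)"
    by blast
  with der have "(f has_field_derivative A 1) (at z)"
    unfolding has_field_derivative_def by simp
  then show "f field_differentiable at z within S"
    using field_differentiable_at_within field_differentiable_def by blast
qed

text \<open>Subtracting the antiderivative \<open>cnj z ^ (q + 1) h\<^sub>q / (q + 1)\<close> of the expansion of \<open>dbar f\<close>
  leaves a solution of the Cauchy--Riemann equations.\<close>
lemma n_analytic_imp_polyanalytic_expansion:
  assumes "open S" "n_analytic_on n f S"
  shows "\<exists>h. polyanalytic_expansion n h f S"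
  using assms(2)
proof (induction n arbitrary: f)
  case 0
  then show ?case by (simp add: n_analytic_on_def polyanalytic_expansion_def)
next
  case (Suc n)
  have smooth: "Ck_on (Suc k) f S" for k
    using Suc.prems unfolding n_analytic_on_def smooth_on_def by blast
  have "Ck_on k (dbar f) S" for k
  proof -
    \<comment> \<open>Written as a linear combination of two directional derivatives,
      \<open>dbar f\<close> inherits all orders of differentiability from \<open>f\<close>.\<close>
    have "Ck_on k (\<lambda>z. (1/2) * frechet_derivative f (at z) 1 + (\<i>/2) * frechet_derivative f (at z) \<i>) S"
      using smooth[of k] by (intro Ck_on_add_cmult[OF assms(1)]) auto
    then show ?thesis
      by (rule Ck_on_cong[OF assms(1), rotated]) (simp add: dbar_def field_simps)
  qed
  moreover have "\<forall>z\<in>S. (dbar ^^ n) (dbar f) z = 0"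
    using Suc.prems by (simp add: n_analytic_on_def funpow_swap1)
  ultimately have "n_analytic_on n (dbar f) S"
    by (simp add: n_analytic_on_def smooth_on_def)
  then obtain h where h: "polyanalytic_expansion n h (dbar f) S"
    using Suc.IH by blast
  define H where "H = (\<lambda>q z. case q of 0 \<Rightarrow> 0 | Suc p \<Rightarrow> h p z / of_nat (Suc p))"
  define F where "F = (\<lambda>z. \<Sum>q<Suc n. cnj z ^ q * H q z)"
  have H: "H q holomorphic_on S" if "q < Suc n" for q
    using h that by (cases q) (auto simp: H_def polyanalytic_expansion_def simp del: of_nat_Suc
        intro!: holomorphic_intros)
  then have F: "polyanalytic_expansion (Suc n) H F S"
    by (simp add: polyanalytic_expansion_def F_def)
  define g where "g = (\<lambda>z. f z - F z)"
  have dF: "F differentiable (at z)" and df: "f differentiable (at z)" if "z \<in> S" for z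
    using polyanalytic_expansion_Ck_on[OF assms(1) F, of 1] smooth[of 0] that by auto
  have "g holomorphic_on S"
  proof (rule dbar_eq_0_imp_holomorphic[OF assms(1)])
    fix z assume z: "z \<in> S"
    show "g differentiable (at z)"
      unfolding g_def using dF[OF z] df[OF z] by simp
    have "frechet_derivative g (at z) =
        (\<lambda>v. frechet_derivative f (at z) v - frechet_derivative F (at z) v)"
      unfolding g_def using dF[OF z] df[OF z]
      by (intro frechet_derivative_at[symmetric] derivative_intros)
        (simp_all add: frechet_derivative_works[symmetric])
    then have "dbar g z = dbar f z - dbar F z"
      by (simp add: dbar_def diff_divide_distrib algebra_simps)
    moreover have "dbar F z = (\<Sum>q<n. cnj z ^ q * h q z)"
      unfolding polyanalytic_expansion_dbar[OF assms(1) F z]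
      by (subst sum.lessThan_Suc_shift) (simp add: H_def del: of_nat_Suc)
    ultimately show "dbar g z = 0"
      using h z by (simp add: polyanalytic_expansion_def)
  qed
  \<comment> \<open>\<open>H 0\<close> is zero, so index 0 is free for the holomorphic remainder
    \<open>g\<close>.\<close>
  have "polyanalytic_expansion (Suc n) (\<lambda>q. if q = 0 then g else H q) f S"
    unfolding polyanalytic_expansion_def
  proof (intro conjI allI impI ballI)
    fix z assume "z \<in> S"
    show "f z = (\<Sum>q<Suc n. cnj z ^ q * (if q = 0 then g else H q) z)"
      unfolding sum.lessThan_Suc_shift
      by (simp add: g_def F_def sum.lessThan_Suc_shift H_def del: of_nat_Suc sum.lessThan_Suc)
  qed (use \<open>g holomorphic_on S\<close> H in auto)
  then show ?case by blast
qed

section \<open>The semi-inner product\<close>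

lemma sum_fun_apply: "(\<Sum>i\<in>F. g i) x = (\<Sum>i\<in>F. g i x)" for g :: "'i \<Rightarrow> 'a \<Rightarrow> complex"
  by (induction F rule: infinite_finite_induct) auto

lemma L2_borel_measurable: "f \<in> L2 M \<Longrightarrow> f \<in> borel_measurable M"
  and L2_integrable: "f \<in> L2 M \<Longrightarrow> integrable M (\<lambda>x. (cmod (f x))\<^sup>2)"
  by (auto simp: L2_def)

text \<open>Follows from |x + y|^2 <= 2 |x|^2 + 2 |y|^2. Sums, differences and multiples are all
  instances.\<close>

lemma L2_cmult_add:
  assumes "f \<in> L2 M" "g \<in> L2 M"
  shows "(\<lambda>x. c * f x + d * g x) \<in> L2 M"
proof -
  have [measurable]: "f \<in> borel_measurable M" "g \<in> borel_measurable M"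
    using assms by (auto simp: L2_def)
  have bound: "(cmod (c * f x + d * g x))\<^sup>2 \<le> 2 * (cmod c)\<^sup>2 * (cmod (f x))\<^sup>2 + 2 * (cmod d)\<^sup>2 * (cmod (g x))\<^sup>2" for x
  proof -
    have "(cmod (c * f x + d * g x))\<^sup>2 \<le> (cmod (c * f x) + cmod (d * g x))\<^sup>2"
      by (intro power_mono norm_triangle_ineq) auto
    also have "\<dots> \<le> 2 * (cmod (c * f x))\<^sup>2 + 2 * (cmod (d * g x))\<^sup>2"
      using sum_squares_bound[of "cmod (c * f x)" "cmod (d * g x)"] by (simp add: power2_sum)
    finally show ?thesis
      by (simp add: norm_mult power_mult_distrib mult.assoc)
  qed
  have "integrable M (\<lambda>x. (cmod (c * f x + d * g x))\<^sup>2)"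
  proof (rule Bochner_Integration.integrable_bound)
    show "integrable M (\<lambda>x. 2 * (cmod c)\<^sup>2 * (cmod (f x))\<^sup>2 + 2 * (cmod d)\<^sup>2 * (cmod (g x))\<^sup>2)"
      using assms by (intro Bochner_Integration.integrable_add integrable_mult_right) (auto simp: L2_def)
  qed (use bound in \<open>auto simp: abs_of_nonneg\<close>)
  then show ?thesis
    by (simp add: L2_def)
qed

lemma L2_add: "f \<in> L2 M \<Longrightarrow> g \<in> L2 M \<Longrightarrow> f + g \<in> L2 M"
  using L2_cmult_add[of f M g 1 1] by (simp add: plus_fun_def)

lemma L2_diff: "f \<in> L2 M \<Longrightarrow> g \<in> L2 M \<Longrightarrow> f - g \<in> L2 M"
  using L2_cmult_add[of f M g 1 "-1"] by (simp add: fun_diff_def)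

lemma L2_zero: "0 \<in> L2 M"
  by (simp add: L2_def zero_fun_def)

lemma L2_fun_scale: "f \<in> L2 M \<Longrightarrow> fun_scale c f \<in> L2 M"
  using L2_cmult_add[of f M f c 0] by (simp add: fun_scale_def)

lemma L2_sum: "(\<And>i. i \<in> F \<Longrightarrow> f i \<in> L2 M) \<Longrightarrow> (\<Sum>i\<in>F. f i) \<in> L2 M"
  by (induction F rule: infinite_finite_induct) (auto intro: L2_add L2_zero)

lemma bounded_in_L2:
  assumes "finite_measure M" "f \<in> borel_measurable M" "\<And>x. x \<in> space M \<Longrightarrow> cmod (f x) \<le> B"
  shows "f \<in> L2 M"
proof -
  interpret finite_measure M by fact
  have "integrable M (\<lambda>x. (cmod (f x))\<^sup>2)"
    using assms(2,3) by (intro integrable_const_bound[where B = "B\<^sup>2"]) (auto intro!: AE_I2 power_mono)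
  with assms(2) show ?thesis by (simp add: L2_def)
qed

lemma borel_measurable_cnj [measurable]:
  "f \<in> borel_measurable M \<Longrightarrow> (\<lambda>x. cnj (f x)) \<in> borel_measurable M"
  by (rule measurable_compose[OF _ borel_measurable_continuous_onI]) (auto intro: continuous_intros)

lemma L2_inner_integrable:
  assumes "f \<in> L2 M" "g \<in> L2 M"
  shows "integrable M (\<lambda>x. f x * cnj (g x))"
proof (rule Bochner_Integration.integrable_bound)
  have [measurable]: "f \<in> borel_measurable M" "g \<in> borel_measurable M"
    using assms by (auto simp: L2_def)
  show "(\<lambda>x. f x * cnj (g x)) \<in> borel_measurable M"
    by measurable
  show "integrable M (\<lambda>x. (cmod (f x))\<^sup>2 + (cmod (g x))\<^sup>2)"
    using assms by (auto simp: L2_def)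
  have "cmod (f x) * cmod (g x) \<le> (cmod (f x))\<^sup>2 + (cmod (g x))\<^sup>2" for x
    using sum_squares_bound[of "cmod (f x)" "cmod (g x)"]
      mult_nonneg_nonneg[OF norm_ge_zero[of "f x"] norm_ge_zero[of "g x"]] by linarith
  then show "AE x in M. norm (f x * cnj (g x)) \<le> norm ((cmod (f x))\<^sup>2 + (cmod (g x))\<^sup>2)"
    by (auto simp: norm_mult intro!: AE_I2)
qed

lemma l2_norm_eq: "l2_norm M f = sqrt (\<integral>x. (cmod (f x))\<^sup>2 \<partial>M)"
proof -
  have "l2_inner M f f = (\<integral>x. complex_of_real ((cmod (f x))\<^sup>2) \<partial>M)"
    unfolding l2_inner_def by (intro Bochner_Integration.integral_cong) (simp_all only: complex_norm_square)
  then show ?thesis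
    by (simp only: l2_norm_def integral_complex_of_real Re_complex_of_real)
qed

lemma l2_norm_nonneg [simp]: "0 \<le> l2_norm M f"
  by (simp add: l2_norm_eq)

lemma l2_norm_power2: "(l2_norm M f)\<^sup>2 = (\<integral>x. (cmod (f x))\<^sup>2 \<partial>M)"
  by (simp add: l2_norm_eq)

section \<open>Orthogonality and pointwise limits\<close>

lemma l2_inner_sum_right_0:
  assumes "\<And>i. i \<in> F \<Longrightarrow> f i \<in> L2 M" "g \<in> L2 M" "\<And>i. i \<in> F \<Longrightarrow> l2_inner M g (f i) = 0"
  shows "l2_inner M g (\<Sum>i\<in>F. f i) = 0"
  using assms
proof (induction F rule: infinite_finite_induct)
  case (insert i F)
  have "l2_inner M g (f i + (\<Sum>i\<in>F. f i)) = l2_inner M g (f i) + l2_inner M g (\<Sum>i\<in>F. f i)"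
    unfolding l2_inner_def using insert.prems
    by (subst Bochner_Integration.integral_add[symmetric])
      (auto simp: algebra_simps intro!: L2_inner_integrable L2_sum)
  also have "l2_inner M g (\<Sum>i\<in>F. f i) = 0"
    using insert by blast
  finally show ?case
    using insert.prems(3)[of i] by (simp only: sum.insert[OF insert.hyps]) simp
qed (auto simp: l2_inner_def)

lemma l2_norm_add_orthogonal:
  assumes "f \<in> L2 M" "g \<in> L2 M" "l2_inner M f g = 0"
  shows "(l2_norm M (f + g))\<^sup>2 = (l2_norm M f)\<^sup>2 + (l2_norm M g)\<^sup>2"
proof -
  have eq: "(cmod (f x + g x))\<^sup>2 = (cmod (f x))\<^sup>2 + (cmod (g x))\<^sup>2 + 2 * Re (f x * cnj (g x))" for x
    unfolding cmod_power2 by (simp add: algebra_simps power2_eq_square)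
  have "(\<integral>x. Re (f x * cnj (g x)) \<partial>M) = 0"
    using integral_Re[OF L2_inner_integrable[OF assms(1,2)]] assms(3) by (simp add: l2_inner_def)
  moreover have "integrable M (\<lambda>x. Re (f x * cnj (g x)))"
    using L2_inner_integrable[OF assms(1,2)] by (rule integrable_Re)
  ultimately show ?thesis
    using assms(1,2) by (simp add: l2_norm_power2 eq L2_integrable del: times_complex.simps)
qed

lemma l2_norm_sum_orthogonal:
  assumes "finite F" "\<And>i. i \<in> F \<Longrightarrow> f i \<in> L2 M"
    and "\<And>i j. i \<in> F \<Longrightarrow> j \<in> F \<Longrightarrow> i \<noteq> j \<Longrightarrow> l2_inner M (f i) (f j) = 0"
  shows "(l2_norm M (\<Sum>i\<in>F. f i))\<^sup>2 = (\<Sum>i\<in>F. (l2_norm M (f i))\<^sup>2)"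
  using assms
proof (induction F rule: finite_induct)
  case empty
  then show ?case by (simp add: l2_norm_power2)
next
  case (insert i F)
  have "(l2_norm M (f i + (\<Sum>i\<in>F. f i)))\<^sup>2 = (l2_norm M (f i))\<^sup>2 + (l2_norm M (\<Sum>i\<in>F. f i))\<^sup>2"
    using insert by (intro l2_norm_add_orthogonal l2_inner_sum_right_0 L2_sum) auto
  also have "(l2_norm M (\<Sum>i\<in>F. f i))\<^sup>2 = (\<Sum>i\<in>F. (l2_norm M (f i))\<^sup>2)"
    using insert by blast
  finally show ?case
    by (simp only: sum.insert[OF insert.hyps])
qed

text \<open>Fatou's lemma for the squared moduli. It serves Bessel's inequality, the estimate of
  remainders and completeness.\<close>

lemma l2_norm_pointwise_limit_le:
  assumes L2: "\<And>j. g j \<in> L2 M" and lim: "\<And>x. x \<in> space M \<Longrightarrow> (\<lambda>j::nat. g j x) \<longlonglongrightarrow> f x"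
    and B: "eventually (\<lambda>j. (l2_norm M (g j))\<^sup>2 \<le> B) sequentially"
  shows "f \<in> L2 M" "(l2_norm M f)\<^sup>2 \<le> B"
proof -
  have [measurable]: "g j \<in> borel_measurable M" for j
    using L2 by (rule L2_borel_measurable)
  have [measurable]: "f \<in> borel_measurable M"
    using lim by (intro borel_measurable_LIMSEQ_metric[of g M f]) auto
  have B0: "0 \<le> B"
    using eventually_happens[OF B] by (auto intro: order_trans[OF zero_le_power2])
  have "(\<integral>\<^sup>+x. ennreal ((cmod (f x))\<^sup>2) \<partial>M) = (\<integral>\<^sup>+x. liminf (\<lambda>j. ennreal ((cmod (g j x))\<^sup>2)) \<partial>M)"
    using lim by (intro nn_integral_cong lim_imp_Liminf[symmetric] tendsto_ennrealI tendsto_power tendsto_norm)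
      auto
  also have "\<dots> \<le> liminf (\<lambda>j. \<integral>\<^sup>+x. ennreal ((cmod (g j x))\<^sup>2) \<partial>M)"
    by (rule nn_integral_liminf) measurable
  also have "\<dots> = liminf (\<lambda>j. ennreal ((l2_norm M (g j))\<^sup>2))"
    using L2_integrable[OF L2] by (simp add: l2_norm_power2 nn_integral_eq_integral)
  also have "\<dots> \<le> liminf (\<lambda>j. ennreal B)"
    using B by (intro Liminf_mono) (auto elim: eventually_mono intro: ennreal_leI)
  also have "\<dots> = ennreal B"
    by (simp add: Liminf_const)
  finally have le: "(\<integral>\<^sup>+x. ennreal ((cmod (f x))\<^sup>2) \<partial>M) \<le> ennreal B" .
  have int: "integrable M (\<lambda>x. (cmod (f x))\<^sup>2)"
    by (rule integrableI_bounded) (use le in \<open>auto simp: order_le_less_trans\<close>)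
  then show "f \<in> L2 M" by (simp add: L2_def)
  from int le B0 show "(l2_norm M f)\<^sup>2 \<le> B"
    by (simp add: l2_norm_power2 nn_integral_eq_integral)
qed

text \<open>A weight condition under the rotation group. Unlike a formula in powers of
  \<open>z\<close> and \<open>cnj z\<close>, it survives multiplication by radial cut-offs.\<close>

definition homogeneous :: "int \<Rightarrow> (complex \<Rightarrow> complex) \<Rightarrow> bool"
  where "homogeneous \<xi> f \<longleftrightarrow> (\<forall>\<theta> z. f (cis \<theta> * z) = cis (\<xi> * \<theta>) * f z)"

text \<open>Rotating by \<open>\<theta> = \<pi> / (2 (\<xi> - \<eta>))\<close> multiplies the inner product by \<open>\<i>\<close>.\<close>
lemma l2_inner_homogeneous_eq_0:
  assumes "f \<in> borel_measurable (mu \<alpha>)" "g \<in> borel_measurable (mu \<alpha>)"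
    and "homogeneous \<xi> f" "homogeneous \<eta> g" "\<xi> \<noteq> \<eta>"
  shows "l2_inner (mu \<alpha>) f g = 0"
proof -
  define \<theta> where "\<theta> = pi / 2 / real_of_int (\<xi> - \<eta>)"
  have \<theta>: "cis (\<xi> * \<theta>) * cnj (cis (\<eta> * \<theta>)) = \<i>"
  proof -
    have "real_of_int (\<xi> - \<eta>) \<noteq> 0"
      using assms(5) by linarith
    then have "real_of_int (\<xi> - \<eta>) * \<theta> = pi / 2"
      using nonzero_eq_divide_eq[of "real_of_int (\<xi> - \<eta>)" \<theta> "pi / 2"] \<theta>_def
      by (metis mult.commute)
    then have "\<xi> * \<theta> - \<eta> * \<theta> = pi / 2"
      by (simp add: left_diff_distrib)
    moreover have "cis (\<xi> * \<theta>) * cnj (cis (\<eta> * \<theta>)) = cis (\<xi> * \<theta> - \<eta> * \<theta>)"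
      by (simp add: cis_cnj cis_mult)
    ultimately show ?thesis by (simp only: cis_pi_half)
  qed
  \<comment> \<open>Distinct integers differ by at least 1, so |\<open>\<theta>\<close>| is at most
    \<open>pi / 2\<close> and the rotation is not the excluded \<open>-1\<close>.\<close>
  have "1 \<le> \<bar>real_of_int (\<xi> - \<eta>)\<bar>"
    using assms(5) by linarith
  then have "pi / 2 / \<bar>real_of_int (\<xi> - \<eta>)\<bar> \<le> pi / 2 / 1"
    by (intro divide_left_mono) auto
  moreover have "\<bar>pi / 2\<bar> = pi / 2"
    by simp
  ultimately have "\<bar>\<theta>\<bar> \<le> pi / 2"
    by (simp only: \<theta>_def abs_divide[of "pi / 2"] div_by_1)
  then have "0 \<le> Re (cis \<theta>)"
    by (auto intro!: cos_ge_zero)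
  then have "cis \<theta> \<noteq> -1" by (auto simp: complex_eq_iff)
  have "l2_inner (mu \<alpha>) f g = (\<integral>z. f (cis \<theta> * z) * cnj (g (cis \<theta> * z)) \<partial>mu \<alpha>)"
    unfolding l2_inner_def using assms(1,2) \<open>cis \<theta> \<noteq> -1\<close>
    by (intro integral_rotation_mu[where f = "\<lambda>z. f z * cnj (g z)", symmetric]) (auto simp del: cis.simps)
  also have "\<dots> = (\<integral>z. \<i> * (f z * cnj (g z)) \<partial>mu \<alpha>)"
    using assms(3,4) by (intro Bochner_Integration.integral_cong)
      (auto simp: homogeneous_def \<theta>[symmetric] simp del: cis.simps)
  also have "\<dots> = \<i> * l2_inner (mu \<alpha>) f g"
    by (simp add: l2_inner_def)
  finally have "(1 - \<i>) * l2_inner (mu \<alpha>) f g = 0"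
    by (simp add: algebra_simps)
  then show ?thesis
    by (auto simp: complex_eq_iff)
qed

section \<open>Power series coefficients and homogeneous components\<close>

text \<open>The first clause says that each power series has radius of convergence at least 1, in a
  form suited to comparison. Coefficients with \<open>q \<ge> n\<close> are unconstrained.\<close>

definition coeff_expansion :: "nat \<Rightarrow> (nat \<Rightarrow> nat \<Rightarrow> complex) \<Rightarrow> (complex \<Rightarrow> complex) \<Rightarrow> bool"
  where "coeff_expansion n a f \<longleftrightarrow>
    (\<forall>q<n. \<forall>r. 0 \<le> r \<and> r < 1 \<longrightarrow> summable (\<lambda>p. cmod (a p q) * r ^ p)) \<and>
    (\<forall>z. f z = (if z \<in> unit_disk then \<Sum>q<n. cnj z ^ q * (\<Sum>p. a p q * z ^ p) else 0))"

lemma coeff_expansion_summable: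
  assumes "coeff_expansion n a f" "q < n" "z \<in> unit_disk"
  shows "summable (\<lambda>p. a p q * z ^ p)"
proof -
  have "summable (\<lambda>p. cmod (a p q) * cmod z ^ p)"
    using assms unfolding coeff_expansion_def by (auto simp: dist_norm)
  then show ?thesis
    by (intro summable_norm_cancel[of "\<lambda>p. a p q * z ^ p"]) (simp add: norm_mult norm_power)
qed

lemma coeff_expansion_imp_n_analytic:
  assumes "coeff_expansion n a f"
  shows "n_analytic_on n f unit_disk"
proof (rule polyanalytic_expansion_imp_n_analytic)
  have "(\<lambda>z. \<Sum>p. a p q * z ^ p) holomorphic_on unit_disk" if "q < n" for q
    using coeff_expansion_summable[OF assms that]
    by (intro power_series_holomorphic[where a = "\<lambda>p. a p q"]) (simp add: summable_sums)
  then show "polyanalytic_expansion n (\<lambda>q z. \<Sum>p. a p q * z ^ p) f unit_disk"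
    using assms by (auto simp: polyanalytic_expansion_def coeff_expansion_def)
qed simp

lemma n_analytic_imp_coeff_expansion:
  assumes "n_analytic_on n f unit_disk" "\<And>z. z \<notin> unit_disk \<Longrightarrow> f z = 0"
  shows "\<exists>a. coeff_expansion n a f"
proof -
  obtain h where h: "polyanalytic_expansion n h f unit_disk"
    using n_analytic_imp_polyanalytic_expansion[OF _ assms(1)] by auto
  define a where "a = (\<lambda>p q. (deriv ^^ p) (h q) 0 / fact p)"
  have sums: "(\<lambda>p. a p q * z ^ p) sums h q z" if "q < n" "z \<in> unit_disk" for q z
    using holomorphic_power_series[of "h q" 0 1 z] h that
    by (simp add: a_def polyanalytic_expansion_def)
  have "summable (\<lambda>p. cmod (a p q) * r ^ p)" if "q < n" "0 \<le> r" "r < 1" for q r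
  proof -
    \<comment> \<open>Convergence at the midpoint of \<open>r\<close> and 1 gives absolute
      convergence at the smaller radius \<open>r\<close>.\<close>
    have "summable (\<lambda>p. a p q * complex_of_real ((r + 1) / 2) ^ p)"
      using that by (intro sums_summable[OF sums]) (auto simp: norm_divide simp flip: of_real_add)
    from powser_insidea[OF this, of "of_real r"] show ?thesis
      using that by (simp add: norm_mult norm_power norm_divide flip: of_real_add)
  qed
  moreover have "f z = (\<Sum>q<n. cnj z ^ q * (\<Sum>p. a p q * z ^ p))" if "z \<in> unit_disk" for z
    using h that sums_unique[OF sums[OF _ that]] by (simp add: polyanalytic_expansion_def)
  ultimately show ?thesis
    using assms(2) by (auto simp: coeff_expansion_def)
qed

lemma coeff_expansion_cmult_add:
  assumes a: "coeff_expansion n a f" and b: "coeff_expansion n b g"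
  shows "coeff_expansion n (\<lambda>p q. c * a p q + d * b p q) (\<lambda>z. c * f z + d * g z)"
  unfolding coeff_expansion_def
proof (intro conjI allI impI)
  fix q r assume q: "q < n" and r: "0 \<le> r \<and> r < (1::real)"
  show "summable (\<lambda>p. cmod (c * a p q + d * b p q) * r ^ p)"
  proof (rule summable_comparison_test')
    show "summable (\<lambda>p. cmod c * (cmod (a p q) * r ^ p) + cmod d * (cmod (b p q) * r ^ p))"
      using a b q r unfolding coeff_expansion_def by (intro summable_add summable_mult) auto
    fix p
    have "cmod (c * a p q + d * b p q) * r ^ p \<le> (cmod c * cmod (a p q) + cmod d * cmod (b p q)) * r ^ p"
      using r by (intro mult_right_mono order_trans[OF norm_triangle_ineq]) (auto simp: norm_mult)
    then show "norm (cmod (c * a p q + d * b p q) * r ^ p) \<le>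
        cmod c * (cmod (a p q) * r ^ p) + cmod d * (cmod (b p q) * r ^ p)"
      using r by (simp add: algebra_simps)
  qed
next
  fix z
  have "(\<Sum>p. (c * a p q + d * b p q) * z ^ p) = c * (\<Sum>p. a p q * z ^ p) + d * (\<Sum>p. b p q * z ^ p)"
    if "q < n" "z \<in> unit_disk" for q
  proof -
    have "(\<lambda>p. c * (a p q * z ^ p) + d * (b p q * z ^ p)) sums
        (c * (\<Sum>p. a p q * z ^ p) + d * (\<Sum>p. b p q * z ^ p))"
      using coeff_expansion_summable[OF a that] coeff_expansion_summable[OF b that]
      by (intro sums_add sums_mult summable_sums)
    then show ?thesis
      by (simp add: sums_iff algebra_simps)
  qed
  then show "c * f z + d * g z = (if z \<in> unit_disk
      then \<Sum>q<n. cnj z ^ q * (\<Sum>p. (c * a p q + d * b p q) * z ^ p) else 0)"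
    using a b unfolding coeff_expansion_def
    by (simp add: sum_distrib_left sum.distrib algebra_simps)
qed

lemma coeff_expansion_zero: "coeff_expansion n (\<lambda>p q. 0) 0"
  by (simp add: coeff_expansion_def)

lemma coeff_expansion_mon:
  assumes "q' < n"
  shows "coeff_expansion n (\<lambda>p q. if p = p' \<and> q = q' then 1 else 0) (mon p' q')"
  unfolding coeff_expansion_def
proof (intro conjI allI impI)
  fix q and r :: real
  show "summable (\<lambda>p. cmod (if p = p' \<and> q = q' then 1 else 0) * r ^ p)"
    by (rule summable_finite[of "{p'}"]) auto
next
  fix z :: complex
  have "(\<Sum>p. (if p = p' \<and> q = q' then 1 else 0) * z ^ p) = (if q = q' then z ^ p' else 0)" for q
    by (subst suminf_finite[of "{p'}"]) auto
  then show "mon p' q' z = (if z \<in> unit_disk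
      then \<Sum>q<n. cnj z ^ q * (\<Sum>p. (if p = p' \<and> q = q' then 1 else 0) * z ^ p) else 0)"
    using assms by (simp add: mon_def if_distrib[of "(*) _"] cong: if_cong)
qed

text \<open>With \<open>p = q + \<xi>\<close>, both sides of
  \<open>min p q < min n (n + \<xi>)\<close> are shifted by \<open>min 0 \<xi>\<close>, so the
  condition reduces to \<open>q < n\<close>, for either sign of \<open>\<xi>\<close>.\<close>

lemma W_space_eq:
  "W_space \<xi> (nat (min (int n) (int n + \<xi>))) =
    cfun_span {mon p q | p q. int p - int q = \<xi> \<and> q < n}"
proof -
  have "min p q < nat (min (int n) (int n + \<xi>)) \<longleftrightarrow> q < n" if "int p - int q = \<xi>" for p q
    using that by (auto simp: min_def)
  then show ?thesis
    unfolding W_space_def by (intro arg_cong[where f = cfun_span]) blast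
qed

text \<open>On the diagonal \<open>p - q = \<xi>\<close> the exponent \<open>p\<close> is determined
  by \<open>q\<close>. The filter removes the \<open>q\<close> for which \<open>p\<close> would be
  negative and \<open>nat\<close> would yield a spurious 0.\<close>

definition homogeneous_part :: "nat \<Rightarrow> (nat \<Rightarrow> nat \<Rightarrow> complex) \<Rightarrow> int \<Rightarrow> complex \<Rightarrow> complex"
  where "homogeneous_part n a \<xi> = (\<Sum>q | q < n \<and> 0 \<le> \<xi> + int q.
    fun_scale (a (nat (\<xi> + int q)) q) (mon (nat (\<xi> + int q)) q))"

lemma homogeneous_part_apply:
  "homogeneous_part n a \<xi> z = (\<Sum>q | q < n \<and> 0 \<le> \<xi> + int q.
    a (nat (\<xi> + int q)) q * mon (nat (\<xi> + int q)) q z)"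
  by (simp add: homogeneous_part_def sum_fun_apply fun_scale_def)

lemma homogeneous_part_in_W_space:
  "homogeneous_part n a \<xi> \<in> W_space \<xi> (nat (min (int n) (int n + \<xi>)))"
proof -
  have "mon (nat (\<xi> + int q)) q \<in> {mon p q | p q. int p - int q = \<xi> \<and> q < n}"
    if "q < n" "0 \<le> \<xi> + int q" for q
    using that by (intro CollectI exI[of _ "nat (\<xi> + int q)"] exI[of _ q]) auto
  then show ?thesis
    unfolding homogeneous_part_def W_space_eq
    by (intro cfun.span_sum cfun.span_scale cfun.span_base) auto
qed

text \<open>The functions with such coefficients form a subspace containing the generators.
  Vanishing off the diagonal is recorded because it passes to limits, which makes the
  \<open>W_space\<close> complete.\<close>

lemma W_space_imp_coeff_expansion:
  assumes "f \<in> W_space \<xi> (nat (min (int n) (int n + \<xi>)))"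
  shows "\<exists>a. coeff_expansion n a f \<and> (\<forall>p q. q < n \<and> int p - int q \<noteq> \<xi> \<longrightarrow> a p q = 0)"
proof -
  let ?T = "{f. \<exists>a. coeff_expansion n a f \<and> (\<forall>p q. q < n \<and> int p - int q \<noteq> \<xi> \<longrightarrow> a p q = 0)}"
  have "cfun_span {mon p q | p q. int p - int q = \<xi> \<and> q < n} \<subseteq> ?T"
  proof (rule cfun.span_minimal)
    show "{mon p q | p q. int p - int q = \<xi> \<and> q < n} \<subseteq> ?T"
      using coeff_expansion_mon by (force split: if_splits)
    have comb: "(\<lambda>z. c * f z + d * g z) \<in> ?T" if f: "f \<in> ?T" and g: "g \<in> ?T" for f g c d
    proof -
      from f obtain a where "coeff_expansion n a f" "\<forall>p q. q < n \<and> int p - int q \<noteq> \<xi> \<longrightarrow> a p q = 0"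
        by blast
      moreover from g obtain b where
        "coeff_expansion n b g" "\<forall>p q. q < n \<and> int p - int q \<noteq> \<xi> \<longrightarrow> b p q = 0"
        by blast
      ultimately show ?thesis
        using coeff_expansion_cmult_add[of n a f b g c d]
        by (intro CollectI exI[of _ "\<lambda>p q. c * a p q + d * b p q"] conjI) auto
    qed
    show "cfun_subspace ?T"
      unfolding cfun.subspace_def
    proof (intro conjI ballI allI)
      show "0 \<in> ?T" using coeff_expansion_zero by fastforce
      fix f g assume "f \<in> ?T" "g \<in> ?T"
      from comb[OF this, of 1 1] show "f + g \<in> ?T" by (simp add: plus_fun_def)
    next
      fix f c assume "f \<in> ?T"
      from comb[OF this this, of c 0] show "fun_scale c f \<in> ?T" by (simp add: fun_scale_def)
    qed
  qed
  with assms show ?thesis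
    unfolding W_space_eq by blast
qed

text \<open>For each \<open>q\<close>, at most one power of \<open>z\<close> lies on the diagonal,
  so every inner series collapses to at most one term.\<close>

lemma coeff_expansion_homogeneous:
  assumes "coeff_expansion n a f" "\<And>p q. q < n \<Longrightarrow> int p - int q \<noteq> \<xi> \<Longrightarrow> a p q = 0"
  shows "f = homogeneous_part n a \<xi>"
proof
  fix z
  have "(\<Sum>p. a p q * z ^ p) = (if 0 \<le> \<xi> + int q then a (nat (\<xi> + int q)) q * z ^ nat (\<xi> + int q) else 0)"
    if "q < n" for q
  proof (cases "0 \<le> \<xi> + int q")
    case True
    have "a p q = 0" if "p \<noteq> nat (\<xi> + int q)" for p
      using assms(2)[OF \<open>q < n\<close>, of p] that True by linarith
    with True show ?thesis
      by (subst suminf_finite[of "{nat (\<xi> + int q)}"]) auto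
  next
    case False
    have "a p q = 0" for p
      using assms(2)[OF \<open>q < n\<close>, of p] False by linarith
    with False show ?thesis by simp
  qed
  then have "(\<Sum>q<n. cnj z ^ q * (\<Sum>p. a p q * z ^ p)) =
      (\<Sum>q<n. if 0 \<le> \<xi> + int q then a (nat (\<xi> + int q)) q * (z ^ nat (\<xi> + int q) * cnj z ^ q) else 0)"
    by (intro sum.cong) auto
  also have "\<dots> = (\<Sum>q | q < n \<and> 0 \<le> \<xi> + int q. a (nat (\<xi> + int q)) q * (z ^ nat (\<xi> + int q) * cnj z ^ q))"
    by (subst sum.inter_filter[symmetric]) simp_all
  finally show "f z = homogeneous_part n a \<xi> z"
    using assms(1) by (simp add: coeff_expansion_def homogeneous_part_apply mon_def)
qed

text \<open>A rotation by \<open>\<theta>\<close> multiplies \<open>mon p q\<close> by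
  \<open>cis ((p - q) * \<theta>)\<close>, and homogeneity is a linear condition.\<close>

lemma homogeneous_W_space:
  assumes "f \<in> W_space \<xi> s"
  shows "homogeneous \<xi> f"
proof -
  have "W_space \<xi> s \<subseteq> {f. homogeneous \<xi> f}"
    unfolding W_space_def
  proof (rule cfun.span_minimal)
    have "mon p q (cis \<theta> * z) = cis (of_int (int p - int q) * \<theta>) * mon p q z" for p q \<theta> z
    proof -
      have "(cis \<theta>) ^ p * cnj (cis \<theta>) ^ q = cis (of_int (int p - int q) * \<theta>)"
        unfolding cis_cnj Complex.DeMoivre cis_mult by (simp add: left_diff_distrib)
      then show ?thesis
        by (simp add: mon_def norm_mult power_mult_distrib mult_ac del: of_int_diff)
    qed
    then show "{mon p q | p q. int p - int q = \<xi> \<and> min p q < s} \<subseteq> {f. homogeneous \<xi> f}"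
      by (auto simp: homogeneous_def)
    show "cfun_subspace {f. homogeneous \<xi> f}"
      by (auto simp: cfun.subspace_def homogeneous_def fun_scale_def algebra_simps)
  qed
  with assms show ?thesis by blast
qed

section \<open>The poly-Bergman space in terms of coefficients\<close>

lemma borel_measurable_mu_continuous:
  assumes "continuous_on unit_disk f"
  shows "f \<in> borel_measurable (mu \<alpha>)"
  using borel_measurable_continuous_on_restrict[OF assms] by (simp cong: measurable_cong_sets add: sets_mu)

lemma mon_L2:
  assumes "\<alpha> > -1"
  shows "mon p q \<in> L2 (mu \<alpha>)"
proof (rule bounded_in_L2[OF finite_measure_mu[OF assms]])
  have "continuous_on unit_disk (\<lambda>z. z ^ p * cnj z ^ q)"
    by (intro continuous_intros)
  then have "continuous_on unit_disk (mon p q)"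
    by (rule continuous_on_eq) (simp add: mon_def)
  then show "mon p q \<in> borel_measurable (mu \<alpha>)"
    by (rule borel_measurable_mu_continuous)
  show "cmod (mon p q z) \<le> 1" for z
    by (auto simp: mon_def norm_mult norm_power intro!: mult_le_one power_le_one)
qed

lemma poly_bergman_iff:
  "f \<in> poly_bergman n \<alpha> \<longleftrightarrow> (\<exists>a. coeff_expansion n a f) \<and> f \<in> L2 (mu \<alpha>)"
  using n_analytic_imp_coeff_expansion[of n f] coeff_expansion_imp_n_analytic[of n _ f]
  by (auto simp: poly_bergman_def) (auto simp: coeff_expansion_def)

lemma subspace_poly_bergman: "cfun_subspace (poly_bergman n \<alpha>)"
proof -
  have comb: "(\<lambda>z. c * f z + d * g z) \<in> poly_bergman n \<alpha>"
    if "f \<in> poly_bergman n \<alpha>" "g \<in> poly_bergman n \<alpha>" for f g c d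
    using that coeff_expansion_cmult_add[of n _ f _ g c d] L2_cmult_add[of f "mu \<alpha>" g c d]
    unfolding poly_bergman_iff by blast
  show ?thesis
    unfolding cfun.subspace_def
  proof (intro conjI ballI allI)
    show "0 \<in> poly_bergman n \<alpha>"
      using coeff_expansion_zero L2_zero unfolding poly_bergman_iff by blast
    fix f g assume "f \<in> poly_bergman n \<alpha>" "g \<in> poly_bergman n \<alpha>"
    from comb[OF this, of 1 1] show "f + g \<in> poly_bergman n \<alpha>" by (simp add: plus_fun_def)
  next
    fix f c assume "f \<in> poly_bergman n \<alpha>"
    from comb[OF this this, of c 0] show "fun_scale c f \<in> poly_bergman n \<alpha>"
      by (simp add: fun_scale_def)
  qed
qed

lemma W_space_subset_poly_bergman:
  assumes "\<alpha> > -1"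
  shows "W_space \<xi> (nat (min (int n) (int n + \<xi>))) \<subseteq> poly_bergman n \<alpha>"
proof -
  have "mon p q \<in> poly_bergman n \<alpha>" if "q < n" for p q
    using coeff_expansion_mon[OF that] mon_L2[OF assms] unfolding poly_bergman_iff by blast
  then show ?thesis
    unfolding W_space_eq by (intro cfun.span_minimal subspace_poly_bergman) auto
qed

lemma continuous_on_poly_bergman:
  assumes "f \<in> poly_bergman n \<alpha>"
  shows "continuous_on unit_disk f"
proof -
  have "Ck_on 0 f unit_disk"
    using assms by (auto simp: poly_bergman_def n_analytic_on_def smooth_on_def simp del: Ck_on.simps)
  then show ?thesis by simp
qed

section \<open>Convergence of the homogeneous decomposition\<close>

lemma sum_homogeneous_part:
  "(\<Sum>\<xi>\<in>{- int n + 1..int N}. homogeneous_part n a \<xi> z) =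
    (\<Sum>q<n. \<Sum>p\<le>N + q. a p q * mon p q z)"
proof -
  have "(\<Sum>\<xi>\<in>{- int n + 1..int N}. homogeneous_part n a \<xi> z) =
      (\<Sum>\<xi>\<in>{- int n + 1..int N}. \<Sum>q\<in>{q. q \<in> {..<n} \<and> 0 \<le> \<xi> + int q}.
        a (nat (\<xi> + int q)) q * mon (nat (\<xi> + int q)) q z)"
    by (simp add: homogeneous_part_apply)
  also have "\<dots> = (\<Sum>q<n. \<Sum>\<xi>\<in>{\<xi>. \<xi> \<in> {- int n + 1..int N} \<and> 0 \<le> \<xi> + int q}.
        a (nat (\<xi> + int q)) q * mon (nat (\<xi> + int q)) q z)"
    by (rule sum.swap_restrict) auto
  also have "\<dots> = (\<Sum>q<n. \<Sum>p\<le>N + q. a p q * mon p q z)"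
  \<comment> \<open>For fixed \<open>q\<close>, the map \<open>\<xi> \<mapsto> \<xi> + q\<close>
    sends the admissible \<open>\<xi>\<close> onto all \<open>p \<le> N + q\<close>: since
    \<open>q < n\<close>, the lower end \<open>- n + 1\<close> is at most \<open>- q\<close>, so no
    \<open>p\<close> is lost.\<close>
  proof (rule sum.cong[OF refl])
    fix q assume "q \<in> {..<n}"
    then show "(\<Sum>\<xi>\<in>{\<xi>. \<xi> \<in> {- int n + 1..int N} \<and> 0 \<le> \<xi> + int q}.
        a (nat (\<xi> + int q)) q * mon (nat (\<xi> + int q)) q z) = (\<Sum>p\<le>N + q. a p q * mon p q z)"
      by (intro sum.reindex_bij_witness[of _ "\<lambda>p. int p - int q" "\<lambda>\<xi>. nat (\<xi> + int q)"]) auto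
  qed
  finally show ?thesis .
qed

lemma sum_homogeneous_part_tendsto:
  assumes "coeff_expansion n a f"
  shows "(\<lambda>N. \<Sum>\<xi>\<in>{- int n + 1..int N}. homogeneous_part n a \<xi> z) \<longlonglongrightarrow> f z"
proof (cases "z \<in> unit_disk")
  case True
  have "(\<lambda>N. \<Sum>p\<le>N + q. a p q * z ^ p) \<longlonglongrightarrow> (\<Sum>p. a p q * z ^ p)" if "q < n" for q
    using LIMSEQ_ignore_initial_segment[OF summable_LIMSEQ'[OF coeff_expansion_summable[OF assms that True]]] .
  then have "(\<lambda>N. \<Sum>q<n. cnj z ^ q * (\<Sum>p\<le>N + q. a p q * z ^ p)) \<longlonglongrightarrow>
      (\<Sum>q<n. cnj z ^ q * (\<Sum>p. a p q * z ^ p))"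
    by (intro tendsto_sum tendsto_mult tendsto_const) auto
  with True assms show ?thesis
    unfolding sum_homogeneous_part by (simp add: coeff_expansion_def mon_def sum_distrib_left mult_ac)
next
  case False
  with assms show ?thesis
    unfolding sum_homogeneous_part by (simp add: coeff_expansion_def mon_def)
qed

text \<open>The bound depends neither on \<open>N\<close> nor on \<open>z\<close>, as required of a
  dominating constant.\<close>

lemma sum_homogeneous_part_bound:
  assumes "coeff_expansion n a f" "cmod z \<le> r" "r < 1"
  shows "cmod (\<Sum>\<xi>\<in>{- int n + 1..int N}. homogeneous_part n a \<xi> z) \<le>
    (\<Sum>q<n. \<Sum>p. cmod (a p q) * r ^ p)"
  unfolding sum_homogeneous_part
proof (intro sum_norm_le)
  fix q assume "q \<in> {..<n}"
  have r: "0 \<le> r" using assms(2) norm_ge_zero[of z] by linarith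
  have "cmod (a p q * mon p q z) \<le> cmod (a p q) * r ^ p" for p
  proof -
    have "cmod z ^ p * cmod z ^ q \<le> r ^ p * 1"
      using assms r by (intro mult_mono power_mono power_le_one) auto
    then have "cmod (mon p q z) \<le> r ^ p"
      using r by (simp add: mon_def norm_mult norm_power)
    then show ?thesis by (simp add: norm_mult mult_left_mono)
  qed
  then have "cmod (\<Sum>p\<le>N + q. a p q * mon p q z) \<le> (\<Sum>p\<le>N + q. cmod (a p q) * r ^ p)"
    by (intro sum_norm_le)
  also have "\<dots> \<le> (\<Sum>p. cmod (a p q) * r ^ p)"
    using assms r \<open>q \<in> {..<n}\<close> by (intro sum_le_suminf) (auto simp: coeff_expansion_def)
  finally show "cmod (\<Sum>p\<le>N + q. a p q * mon p q z) \<le> (\<Sum>p. cmod (a p q) * r ^ p)" .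
qed

text \<open>Cutting off at a radius below 1 makes the partial sums uniformly bounded, and being
  radial it keeps components of different weights orthogonal.\<close>

definition cut :: "real \<Rightarrow> (complex \<Rightarrow> complex) \<Rightarrow> complex \<Rightarrow> complex"
  where "cut r f z = (if cmod z < r then f z else 0)"

lemma borel_measurable_cut:
  assumes "f \<in> borel_measurable (mu \<alpha>)"
  shows "cut r f \<in> borel_measurable (mu \<alpha>)"
proof -
  have "{z \<in> space (mu \<alpha>). cmod z < r} = ball 0 r \<inter> unit_disk" by auto
  then have "{z \<in> space (mu \<alpha>). cmod z < r} \<in> sets (mu \<alpha>)" by (simp add: in_sets_mu_iff)
  then show ?thesis
    using assms unfolding cut_def by (intro measurable_If) auto
qed

lemma L2_cut:
  assumes "f \<in> L2 (mu \<alpha>)"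
  shows "cut r f \<in> L2 (mu \<alpha>)" "(l2_norm (mu \<alpha>) (cut r f))\<^sup>2 \<le> (l2_norm (mu \<alpha>) f)\<^sup>2"
proof -
  have [measurable]: "f \<in> borel_measurable (mu \<alpha>)" using assms by (rule L2_borel_measurable)
  have meas [measurable]: "cut r f \<in> borel_measurable (mu \<alpha>)"
    by (rule borel_measurable_cut) measurable
  have int: "integrable (mu \<alpha>) (\<lambda>z. (cmod (cut r f z))\<^sup>2)"
  proof (rule Bochner_Integration.integrable_bound[OF L2_integrable[OF assms]])
    show "AE z in mu \<alpha>. norm ((cmod (cut r f z))\<^sup>2) \<le> norm ((cmod (f z))\<^sup>2)"
      by (simp add: cut_def)
  qed measurable
  then show "cut r f \<in> L2 (mu \<alpha>)" using meas by (simp add: L2_def)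
  show "(l2_norm (mu \<alpha>) (cut r f))\<^sup>2 \<le> (l2_norm (mu \<alpha>) f)\<^sup>2"
    unfolding l2_norm_power2
    by (intro integral_mono int L2_integrable[OF assms]) (auto simp: cut_def)
qed

lemma homogeneous_cut: "homogeneous \<xi> f \<Longrightarrow> homogeneous \<xi> (cut r f)"
  by (auto simp: homogeneous_def cut_def norm_mult)

lemma homogeneous_part_homogeneous: "homogeneous \<xi> (homogeneous_part n a \<xi>)"
  using homogeneous_W_space homogeneous_part_in_W_space by blast

lemma homogeneous_part_poly_bergman:
  assumes "\<alpha> > -1"
  shows "homogeneous_part n a \<xi> \<in> poly_bergman n \<alpha>"
  using W_space_subset_poly_bergman[OF assms] homogeneous_part_in_W_space by blast

lemma homogeneous_part_L2:
  assumes "\<alpha> > -1"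
  shows "homogeneous_part n a \<xi> \<in> L2 (mu \<alpha>)"
  using homogeneous_part_poly_bergman[OF assms] by (auto simp: poly_bergman_def)

lemma l2_norm_sum_homogeneous:
  assumes "finite F" "\<And>\<xi>. \<xi> \<in> F \<Longrightarrow> g \<xi> \<in> L2 (mu \<alpha>)" "\<And>\<xi>. \<xi> \<in> F \<Longrightarrow> homogeneous \<xi> (g \<xi>)"
  shows "(l2_norm (mu \<alpha>) (\<Sum>\<xi>\<in>F. g \<xi>))\<^sup>2 = (\<Sum>\<xi>\<in>F. (l2_norm (mu \<alpha>) (g \<xi>))\<^sup>2)"
  using assms by (intro l2_norm_sum_orthogonal l2_inner_homogeneous_eq_0 L2_borel_measurable)

lemma finite_subset_atLeast_int:
  fixes F :: "int set"
  assumes "finite F" "F \<subseteq> {m..}"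
  shows "eventually (\<lambda>N. F \<subseteq> {m..int N}) sequentially"
proof -
  obtain k where k: "\<And>x. x \<in> F \<Longrightarrow> x \<le> k"
    using assms(1) by (meson bdd_above.E bdd_above_finite)
  have "F \<subseteq> {m..int N}" if "N \<ge> nat k" for N
    using that k assms(2) by force
  then show ?thesis
    unfolding eventually_sequentially by blast
qed

text \<open>On the smaller disk the norms of the partial sums converge to that of
  \<open>cut r f\<close> by dominated convergence. By orthogonality each partial sum containing
  \<open>F\<close> has at least the squared norm of the part over \<open>F\<close>.\<close>

lemma bessel_cut:
  assumes "\<alpha> > -1" "coeff_expansion n a f" "f \<in> L2 (mu \<alpha>)" "0 \<le> r" "r < 1"
    and F: "finite F" "F \<subseteq> {- int n + 1..}"
  shows "(\<Sum>\<xi>\<in>F. (l2_norm (mu \<alpha>) (cut r (homogeneous_part n a \<xi>)))\<^sup>2) \<le> (l2_norm (mu \<alpha>) f)\<^sup>2"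
proof -
  interpret finite_measure "mu \<alpha>" using assms(1) by (rule finite_measure_mu)
  define g where "g = (\<lambda>\<xi>. cut r (homogeneous_part n a \<xi>))"
  define S where "S = (\<lambda>N::nat. \<Sum>\<xi>\<in>{- int n + 1..int N}. g \<xi>)"
  define B where "B = (\<Sum>q<n. \<Sum>p. cmod (a p q) * r ^ p)"
  have gL2: "g \<xi> \<in> L2 (mu \<alpha>)" for \<xi>
    unfolding g_def by (intro L2_cut homogeneous_part_L2 assms)
  have S_apply: "S N z = cut r (\<lambda>z. \<Sum>\<xi>\<in>{- int n + 1..int N}. homogeneous_part n a \<xi> z) z" for N z
    by (simp add: S_def g_def cut_def sum_fun_apply)
  have "(\<lambda>N. \<integral>z. (cmod (S N z))\<^sup>2 \<partial>mu \<alpha>) \<longlonglongrightarrow> (\<integral>z. (cmod (cut r f z))\<^sup>2 \<partial>mu \<alpha>)"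
  proof (rule integral_dominated_convergence)
    show "(\<lambda>z. (cmod (cut r f z))\<^sup>2) \<in> borel_measurable (mu \<alpha>)"
      using L2_integrable[OF L2_cut(1)[OF assms(3)]] by (rule borel_measurable_integrable)
    show "(\<lambda>z. (cmod (S N z))\<^sup>2) \<in> borel_measurable (mu \<alpha>)" for N
      unfolding S_def by (intro borel_measurable_integrable L2_integrable L2_sum gL2)
    show "integrable (mu \<alpha>) (\<lambda>_. B\<^sup>2)" by simp
    have "(\<lambda>N. S N z) \<longlonglongrightarrow> cut r f z" for z
      using sum_homogeneous_part_tendsto[OF assms(2), of z] by (simp add: S_apply cut_def)
    then show "AE z in mu \<alpha>. (\<lambda>N. (cmod (S N z))\<^sup>2) \<longlonglongrightarrow> (cmod (cut r f z))\<^sup>2"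
      by (intro AE_I2 tendsto_power tendsto_norm)
    have "cmod (S N z) \<le> B" for N z
    proof (cases "cmod z < r")
      case True
      then show ?thesis
        unfolding S_apply cut_def B_def using sum_homogeneous_part_bound[OF assms(2) _ assms(5), of z] by simp
    next
      case False
      have "0 \<le> B" unfolding B_def using assms(2,4,5)
        by (intro sum_nonneg suminf_nonneg) (auto simp: coeff_expansion_def)
      with False show ?thesis by (simp add: S_apply cut_def)
    qed
    then show "AE z in mu \<alpha>. norm ((cmod (S N z))\<^sup>2) \<le> B\<^sup>2" for N
      by (intro AE_I2) (simp add: power_mono)
  qed
  then have "(\<lambda>N. (l2_norm (mu \<alpha>) (S N))\<^sup>2) \<longlonglongrightarrow> (l2_norm (mu \<alpha>) (cut r f))\<^sup>2"
    by (simp add: l2_norm_power2)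
  moreover have "eventually (\<lambda>N. (\<Sum>\<xi>\<in>F. (l2_norm (mu \<alpha>) (g \<xi>))\<^sup>2) \<le> (l2_norm (mu \<alpha>) (S N))\<^sup>2) sequentially"
    using finite_subset_atLeast_int[OF F]
  proof eventually_elim
    case (elim N)
    have "(l2_norm (mu \<alpha>) (S N))\<^sup>2 = (\<Sum>\<xi>\<in>{- int n + 1..int N}. (l2_norm (mu \<alpha>) (g \<xi>))\<^sup>2)"
      unfolding S_def using gL2
      by (intro l2_norm_sum_homogeneous) (auto simp: g_def intro: homogeneous_cut homogeneous_part_homogeneous)
    with elim show ?case by (simp add: sum_mono2)
  qed
  ultimately have "(\<Sum>\<xi>\<in>F. (l2_norm (mu \<alpha>) (g \<xi>))\<^sup>2) \<le> (l2_norm (mu \<alpha>) (cut r f))\<^sup>2"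
    by (rule tendsto_lowerbound) simp
  also have "\<dots> \<le> (l2_norm (mu \<alpha>) f)\<^sup>2"
    by (rule L2_cut) fact
  finally show ?thesis by (simp add: g_def)
qed

lemma bessel:
  assumes "\<alpha> > -1" "coeff_expansion n a f" "f \<in> L2 (mu \<alpha>)"
    and F: "finite F" "F \<subseteq> {- int n + 1..}"
  shows "(\<Sum>\<xi>\<in>F. (l2_norm (mu \<alpha>) (homogeneous_part n a \<xi>))\<^sup>2) \<le> (l2_norm (mu \<alpha>) f)\<^sup>2"
proof -
  define r where "r = (\<lambda>j::nat. 1 - 1 / real (Suc j))"
  define g where "g = (\<lambda>j \<xi>. cut (r j) (homogeneous_part n a \<xi>))"
  have gL2: "g j \<xi> \<in> L2 (mu \<alpha>)" for j \<xi>
    unfolding g_def by (intro L2_cut homogeneous_part_L2 assms)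
  have "r \<longlonglongrightarrow> 1 - 0"
    unfolding r_def by (intro tendsto_diff tendsto_const LIMSEQ_Suc lim_1_over_n)
  then have r: "r \<longlonglongrightarrow> 1" by simp
  \<comment> \<open>Fatou's lemma is applied to the finite sum as a whole; orthogonality splits the
    norm both before and after the limit.\<close>
  have "(l2_norm (mu \<alpha>) (\<Sum>\<xi>\<in>F. homogeneous_part n a \<xi>))\<^sup>2 \<le> (l2_norm (mu \<alpha>) f)\<^sup>2"
  proof (rule l2_norm_pointwise_limit_le(2))
    show "(\<Sum>\<xi>\<in>F. g j \<xi>) \<in> L2 (mu \<alpha>)" for j
      by (intro L2_sum gL2)
    show "(\<lambda>j. (\<Sum>\<xi>\<in>F. g j \<xi>) z) \<longlonglongrightarrow> (\<Sum>\<xi>\<in>F. homogeneous_part n a \<xi>) z"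
      if "z \<in> space (mu \<alpha>)" for z
    \<comment> \<open>Every fixed point of the disk lies within all but finitely many of the cut-off
      radii.\<close>
    proof (rule tendsto_eventually)
      have "eventually (\<lambda>j. cmod z < r j) sequentially"
        using order_tendstoD(1)[OF r, of "cmod z"] that by simp
      then show "eventually (\<lambda>j. (\<Sum>\<xi>\<in>F. g j \<xi>) z = (\<Sum>\<xi>\<in>F. homogeneous_part n a \<xi>) z) sequentially"
        by eventually_elim (simp add: g_def cut_def sum_fun_apply)
    qed
    have "(l2_norm (mu \<alpha>) (\<Sum>\<xi>\<in>F. g j \<xi>))\<^sup>2 = (\<Sum>\<xi>\<in>F. (l2_norm (mu \<alpha>) (g j \<xi>))\<^sup>2)" for j
      using F(1) gL2
      by (intro l2_norm_sum_homogeneous) (auto simp: g_def intro: homogeneous_cut homogeneous_part_homogeneous)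
    then show "eventually (\<lambda>j. (l2_norm (mu \<alpha>) (\<Sum>\<xi>\<in>F. g j \<xi>))\<^sup>2 \<le> (l2_norm (mu \<alpha>) f)\<^sup>2) sequentially"
      using bessel_cut[OF assms(1-3) _ _ F] by (simp add: g_def r_def)
  qed
  then show ?thesis
    using F(1) assms(1)
    by (subst (asm) l2_norm_sum_homogeneous)
      (auto intro: homogeneous_part_L2 homogeneous_part_homogeneous)
qed

lemma l2_norm_uminus: "l2_norm M (- f) = l2_norm M f"
  by (simp add: l2_norm_eq)

lemma homogeneous_parts_has_sum:
  assumes "\<alpha> > -1" "coeff_expansion n a f" "f \<in> L2 (mu \<alpha>)"
  shows "l2_has_sum (mu \<alpha>) (homogeneous_part n a) f {- int n + 1..}"
proof -
  let ?I = "{- int n + 1..}"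
  let ?P = "homogeneous_part n a"
  define c where "c = (\<lambda>\<xi>. (l2_norm (mu \<alpha>) (?P \<xi>))\<^sup>2)"
  \<comment> \<open>The total of the squared norms; by Bessel's inequality the series
    converges.\<close>
  define s where "s = infsum c ?I"
  have "c summable_on ?I"
    using bessel[OF assms]
    by (intro nonneg_bounded_partial_sums_imp_summable_on[of _ _ "(l2_norm (mu \<alpha>) f)\<^sup>2"]
        eventually_finite_subsets_at_top_weakI) (auto simp: c_def)
  then have hs: "(c has_sum s) ?I"
    unfolding s_def by (rule has_sum_infsum)
  have le_s: "sum c G \<le> s" if "finite G" "G \<subseteq> ?I" for G
    using finite_sum_le_has_sum[OF hs that] by (auto simp: c_def)
  \<comment> \<open>The remainder is the pointwise limit of sums over \<open>F\<close> minus longer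
    partial sums. Orthogonality evaluates these squared norms as sums of \<open>c\<close> outside
    \<open>F\<close>, which are at most the tail.\<close>
  have bound: "(l2_norm (mu \<alpha>) ((\<Sum>\<xi>\<in>F. ?P \<xi>) - f))\<^sup>2 \<le> s - sum c F"
    if F: "finite F" "F \<subseteq> ?I" for F
  proof (rule l2_norm_pointwise_limit_le(2))
    let ?S = "\<lambda>N. \<Sum>\<xi>\<in>{- int n + 1..int N}. ?P \<xi>"
    show "(\<Sum>\<xi>\<in>F. ?P \<xi>) - ?S N \<in> L2 (mu \<alpha>)" for N
      by (intro L2_diff L2_sum homogeneous_part_L2 assms)
    show "(\<lambda>N. ((\<Sum>\<xi>\<in>F. ?P \<xi>) - ?S N) z) \<longlonglongrightarrow> ((\<Sum>\<xi>\<in>F. ?P \<xi>) - f) z" for z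
      using tendsto_diff[OF tendsto_const sum_homogeneous_part_tendsto[OF assms(2), of z]]
      by (simp add: sum_fun_apply)
    show "eventually (\<lambda>N. (l2_norm (mu \<alpha>) ((\<Sum>\<xi>\<in>F. ?P \<xi>) - ?S N))\<^sup>2 \<le> s - sum c F) sequentially"
      using finite_subset_atLeast_int[OF F]
    proof eventually_elim
      case (elim N)
      let ?J = "{- int n + 1..int N}"
      have "(\<Sum>\<xi>\<in>F. ?P \<xi>) - ?S N = - (\<Sum>\<xi>\<in>?J - F. ?P \<xi>)"
        using sum_diff[OF _ elim, of ?P] by simp
      then have "(l2_norm (mu \<alpha>) ((\<Sum>\<xi>\<in>F. ?P \<xi>) - ?S N))\<^sup>2 = sum c (?J - F)"
        unfolding c_def l2_norm_uminus using assms(1)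
        by (simp only: l2_norm_uminus)
          (intro l2_norm_sum_homogeneous homogeneous_part_L2 homogeneous_part_homogeneous; simp)
      also have "\<dots> = sum c ?J - sum c F"
        by (intro sum_diff elim) simp
      also have "\<dots> \<le> s - sum c F"
        using le_s[of ?J] by auto
      finally show ?case .
    qed
  qed
  have lim: "((\<lambda>F. sqrt (s - sum c F)) \<longlongrightarrow> sqrt (s - s)) (finite_subsets_at_top ?I)"
    using hs unfolding has_sum_def by (intro tendsto_real_sqrt tendsto_diff tendsto_const)
  show ?thesis
    unfolding l2_has_sum_def
  proof (rule tendsto_sandwich[where f = "\<lambda>_. 0" and h = "\<lambda>F. sqrt (s - sum c F)"])
    show "eventually (\<lambda>F. l2_norm (mu \<alpha>) ((\<Sum>\<xi>\<in>F. ?P \<xi>) - f) \<le> sqrt (s - sum c F))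
        (finite_subsets_at_top ?I)"
      using bound by (intro eventually_finite_subsets_at_top_weakI real_le_rsqrt) auto
    show "((\<lambda>F. sqrt (s - sum c F)) \<longlongrightarrow> 0) (finite_subsets_at_top ?I)"
      using lim by simp
  qed (auto intro!: always_eventually)
qed

section \<open>Estimates for the coefficients\<close>

text \<open>Dividing by the linear factor at the last node leaves a quotient of lower degree, whose
  values at the other nodes are divided differences and hence controlled by the separation
  \<open>\<delta>\<close>. The constant is uniform in nodes and polynomial.\<close>

lemma poly_coeff_bound:
  fixes \<delta> :: real
  assumes "\<delta> > 0"
  shows "\<exists>C\<ge>0. \<forall>(t :: nat \<Rightarrow> complex) P k. (\<forall>i\<le>n. cmod (t i) \<le> 1) \<longrightarrow>
    (\<forall>i j. i < j \<and> j \<le> n \<longrightarrow> \<delta> \<le> cmod (t i - t j)) \<longrightarrow> degree P \<le> n \<longrightarrow>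
    cmod (coeff P k) \<le> C * (\<Sum>i\<le>n. cmod (poly P (t i)))"
proof (induction n)
  case 0
  have "cmod (coeff P k) \<le> 1 * cmod (poly P (t 0))" if "degree P \<le> 0" for t :: "nat \<Rightarrow> complex" and P k
  proof -
    obtain c where "P = [:c:]" using \<open>degree P \<le> 0\<close> by (metis degree_eq_zeroE le_zero_eq)
    then show ?thesis by (cases k) auto
  qed
  then show ?case by (intro exI[of _ 1]) auto
next
  case (Suc n)
  then obtain C where C: "C \<ge> 0" "\<And>(t :: nat \<Rightarrow> complex) P k. (\<forall>i\<le>n. cmod (t i) \<le> 1) \<Longrightarrow>
      (\<forall>i j. i < j \<and> j \<le> n \<longrightarrow> \<delta> \<le> cmod (t i - t j)) \<Longrightarrow> degree P \<le> n \<Longrightarrow>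
      cmod (coeff P k) \<le> C * (\<Sum>i\<le>n. cmod (poly P (t i)))"
    by blast
  \<comment> \<open>Chosen so that \<open>C' * T = 2 * U + T\<close>, with \<open>U\<close> the
    bound below for the coefficients of the quotient.\<close>
  define C' where "C' = 2 * (C * ((real n + 1) * (2 / \<delta>))) + 1"
  have "cmod (coeff P k) \<le> C' * (\<Sum>i\<le>Suc n. cmod (poly P (t i)))"
    if t1: "\<forall>i\<le>Suc n. cmod (t i) \<le> 1"
      and sep: "\<forall>i j. i < j \<and> j \<le> Suc n \<longrightarrow> \<delta> \<le> cmod (t i - t j)"
      and deg: "degree P \<le> Suc n" for t :: "nat \<Rightarrow> complex" and P k
  proof -
    define x where "x = t (Suc n)"
    define Q where "Q = synthetic_div P x"
    define T where "T = (\<Sum>i\<le>Suc n. cmod (poly P (t i)))"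
    have P: "P = [:- x, 1:] * Q + [:poly P x:]"
      unfolding Q_def by (rule synthetic_div_correct'[symmetric])
    have degQ: "degree Q \<le> n"
      using deg by (simp add: Q_def degree_synthetic_div)
    have T: "cmod (poly P (t i)) \<le> T" if "i \<le> Suc n" for i
      unfolding T_def using that by (intro member_le_sum) auto
    have Px: "cmod (poly P x) \<le> T"
      using T[of "Suc n"] by (simp add: x_def)
    have "0 \<le> T" unfolding T_def by (intro sum_nonneg) auto
    have Qt: "cmod (poly Q (t i)) \<le> 2 * T / \<delta>" if "i \<le> n" for i
    proof -
      have "poly P (t i) = (t i - x) * poly Q (t i) + poly P x"
        by (subst (1) P) (simp add: algebra_simps)
      then have "cmod (t i - x) * cmod (poly Q (t i)) = cmod (poly P (t i) - poly P x)"
        by (simp add: norm_mult)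
      also have "\<dots> \<le> 2 * T"
        using norm_triangle_ineq4[of "poly P (t i)" "poly P x"] T[of "Suc n"] T[of i] that
        by (simp add: x_def)
      finally have "cmod (t i - x) * cmod (poly Q (t i)) \<le> 2 * T" .
      moreover have "\<delta> * cmod (poly Q (t i)) \<le> cmod (t i - x) * cmod (poly Q (t i))"
        using sep that by (intro mult_right_mono) (auto simp: x_def)
      ultimately show ?thesis
        using assms by (simp add: pos_le_divide_eq mult.commute)
    qed
    define U where "U = C * ((real n + 1) * (2 * T / \<delta>))"
    have Qk: "cmod (coeff Q k) \<le> U" for k
    proof -
      have "cmod (coeff Q k) \<le> C * (\<Sum>i\<le>n. cmod (poly Q (t i)))"
        using t1 sep degQ by (intro C(2)) auto
      also have "\<dots> \<le> C * (\<Sum>i\<le>n. 2 * T / \<delta>)"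
        using C(1) by (intro mult_left_mono sum_mono Qt) auto
      finally show ?thesis by (simp add: U_def add.commute)
    qed
    have x1: "cmod x * cmod y \<le> cmod y" for y
      using t1 by (simp add: x_def mult_left_le_one_le)
    have "cmod (coeff P k) \<le> 2 * U + T"
    proof (cases k)
      case 0
      have "coeff P k = - (x * coeff Q 0) + poly P x"
        by (subst P) (simp add: 0)
      then have "cmod (coeff P k) \<le> cmod x * cmod (coeff Q 0) + cmod (poly P x)"
        using norm_triangle_ineq[of "- (x * coeff Q 0)" "poly P x"] by (simp add: norm_mult)
      with x1[of "coeff Q 0"] Qk[of 0] Px order_trans[OF norm_ge_zero Qk[of 0]] show ?thesis
        by linarith
    next
      case (Suc l)
      have "coeff P k = coeff Q l - x * coeff Q k"
        by (subst P) (simp add: Suc)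
      then have "cmod (coeff P k) \<le> cmod (coeff Q l) + cmod x * cmod (coeff Q k)"
        using norm_triangle_ineq4[of "coeff Q l" "x * coeff Q k"] by (simp add: norm_mult)
      with x1[of "coeff Q k"] Qk[of k] Qk[of l] \<open>0 \<le> T\<close> show ?thesis by linarith
    qed
    also have "\<dots> = C' * T"
      by (simp add: C'_def U_def algebra_simps)
    finally show ?thesis by (simp only: T_def)
  qed
  moreover have "0 \<le> C'" using C(1) assms by (simp add: C'_def)
  ultimately show ?case by blast
qed

text \<open>The minimum of |f|^2 on the compact ball, times the measure of the open ball, is at most
  the integral of |f|^2. Continuity replaces a mean value property.\<close>

lemma exists_value_le_l2_norm:
  assumes "\<alpha> > -1" "f \<in> L2 (mu \<alpha>)" "continuous_on unit_disk f" "e > 0" "cball x e \<subseteq> unit_disk"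
  shows "\<exists>z\<in>cball x e. measure (mu \<alpha>) (ball x e) * (cmod (f z))\<^sup>2 \<le> (l2_norm (mu \<alpha>) f)\<^sup>2"
proof -
  interpret finite_measure "mu \<alpha>" using assms(1) by (rule finite_measure_mu)
  have "continuous_on (cball x e) (\<lambda>z. cmod (f z))"
    using assms by (intro continuous_intros) (blast intro: continuous_on_subset)
  then obtain z where z: "z \<in> cball x e" "\<And>w. w \<in> cball x e \<Longrightarrow> cmod (f z) \<le> cmod (f w)"
    using continuous_attains_inf[of "cball x e" "\<lambda>z. cmod (f z)"] assms(4) by auto
  have ball: "ball x e \<in> sets (mu \<alpha>)"
    using assms(5) ball_subset_cball[of x e] by (auto simp: in_sets_mu_iff simp del: ball_subset_cball)
  have "measure (mu \<alpha>) (ball x e) * (cmod (f z))\<^sup>2 = (\<integral>w. indicator (ball x e) w * (cmod (f z))\<^sup>2 \<partial>mu \<alpha>)"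
    using sets.sets_into_space[OF ball] by (simp add: Int_absorb2)
  also have "\<dots> \<le> (\<integral>w. (cmod (f w))\<^sup>2 \<partial>mu \<alpha>)"
  proof (rule integral_mono)
    show "integrable (mu \<alpha>) (\<lambda>w. indicator (ball x e) w * (cmod (f z))\<^sup>2)"
      using ball by (intro integrable_mult_left integrable_real_indicator) (auto simp: emeasure_eq_measure)
    show "indicator (ball x e) w * (cmod (f z))\<^sup>2 \<le> (cmod (f w))\<^sup>2" for w
      using z(2)[of w] by (auto simp: indicator_def intro!: power_mono)
  qed (rule L2_integrable[OF assms(2)])
  finally show ?thesis
    using z(1) by (auto simp: l2_norm_power2)
qed

text \<open>A nonzero value persists on a small ball by continuity, and that ball has positive
  measure.\<close>

lemma poly_bergman_l2_norm_eq_0: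
  assumes "\<alpha> > -1" "f \<in> poly_bergman n \<alpha>" "l2_norm (mu \<alpha>) f = 0"
  shows "f = 0"
proof (rule ccontr)
  have f: "f \<in> L2 (mu \<alpha>)" "continuous_on unit_disk f" "\<And>z. z \<notin> unit_disk \<Longrightarrow> f z = 0"
    using assms(2) continuous_on_poly_bergman[OF assms(2)] by (auto simp: poly_bergman_def)
  assume "f \<noteq> 0"
  then obtain z where z: "f z \<noteq> 0" by (auto simp: fun_eq_iff)
  then have "z \<in> unit_disk" using f(3) by blast
  have "{w \<in> unit_disk. f w \<noteq> 0} = unit_disk \<inter> f -` (- {0})"
    by auto
  also have "open \<dots>"
    using f(2) by (intro continuous_open_preimage) auto
  finally obtain e where e: "e > 0" "cball z e \<subseteq> {w \<in> unit_disk. f w \<noteq> 0}"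
    using z \<open>z \<in> unit_disk\<close> unfolding open_contains_cball by blast
  have "cball z e \<subseteq> unit_disk"
    using e(2) by blast
  from exists_value_le_l2_norm[OF assms(1) f(1,2) e(1) this]
  obtain w where w: "w \<in> cball z e" "measure (mu \<alpha>) (ball z e) * (cmod (f w))\<^sup>2 \<le> 0"
    using assms(3) by auto
  have "measure (mu \<alpha>) (ball z e) > 0"
    using e(1) order_trans[OF ball_subset_cball \<open>cball z e \<subseteq> unit_disk\<close>]
    by (intro measure_mu_pos assms(1)) auto
  moreover have "f w \<noteq> 0" using w e by auto
  ultimately have "measure (mu \<alpha>) (ball z e) * (cmod (f w))\<^sup>2 > 0" by simp
  with w show False by simp
qed

text \<open>On a circle \<open>|z|\<^sup>2 = t\<close> the component of degree \<open>\<xi>\<close> has modulus \<open>|z|\<^sup>\<xi> |R t|\<close>; the factor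
  \<open>z ^ n\<close> avoids negative exponents.\<close>
lemma homogeneous_part_poly:
  assumes "q' < n" "\<xi> = int p' - int q'"
  obtains R where "degree R \<le> n - 1" "coeff R q' = a p' q'"
    "\<And>z. z \<in> unit_disk \<Longrightarrow>
      z ^ n * homogeneous_part n a \<xi> z = z ^ (n + p' - q') * poly R (of_real ((cmod z)\<^sup>2))"
proof
  let ?Q = "{q. q < n \<and> 0 \<le> \<xi> + int q}"
  define R where "R = (\<Sum>q\<in>?Q. monom (a (nat (\<xi> + int q)) q) q)"
  show "degree R \<le> n - 1"
    unfolding R_def by (intro degree_sum_le) (auto intro: order_trans[OF degree_monom_le])
  show "coeff R q' = a p' q'"
    using assms by (simp add: R_def coeff_sum if_distrib cong: if_cong)
  fix z :: complex assume z: "z \<in> unit_disk"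
  have "z ^ n * (a (nat (\<xi> + int q)) q * mon (nat (\<xi> + int q)) q z) =
      z ^ (n + p' - q') * (a (nat (\<xi> + int q)) q * of_real ((cmod z)\<^sup>2) ^ q)" if "q \<in> ?Q" for q
  proof -
    \<comment> \<open>The natural subtraction in \<open>n + p' - q'\<close> does not truncate,
      because \<open>q' < n\<close>.\<close>
    have "n + nat (\<xi> + int q) = (n + p' - q') + q"
      using that assms by auto
    then have "z ^ n * z ^ nat (\<xi> + int q) = z ^ (n + p' - q') * z ^ q"
      by (metis power_add)
    then have "z ^ n * mon (nat (\<xi> + int q)) q z = z ^ (n + p' - q') * (z * cnj z) ^ q"
      using z by (simp add: mon_def power_mult_distrib mult.assoc[symmetric])
    then show ?thesis
      by (simp add: complex_norm_square algebra_simps del: of_real_power)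
  qed
  then have "(\<Sum>q\<in>?Q. z ^ n * (a (nat (\<xi> + int q)) q * mon (nat (\<xi> + int q)) q z)) =
      (\<Sum>q\<in>?Q. z ^ (n + p' - q') * (a (nat (\<xi> + int q)) q * of_real ((cmod z)\<^sup>2) ^ q))"
    by (rule sum.cong[OF refl])
  then show "z ^ n * homogeneous_part n a \<xi> z = z ^ (n + p' - q') * poly R (of_real ((cmod z)\<^sup>2))"
    by (simp only: homogeneous_part_apply R_def poly_sum poly_monom sum_distrib_left)
qed

text \<open>The quantitative core of completeness: one constant serves all functions and all
  coefficients. Weighting by powers of \<open>\<rho>\<close> compensates for the decay of
  \<open>mon p q\<close> as \<open>p\<close> grows.\<close>

lemma coeff_bound:
  assumes \<alpha>: "\<alpha> > -1" and \<rho>: "0 < \<rho>" "\<rho> < 1"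
  shows "\<exists>C\<ge>0. \<forall>a f p q. coeff_expansion n a f \<and> f \<in> L2 (mu \<alpha>) \<and> q < n \<longrightarrow>
    cmod (a p q) * \<rho> ^ p \<le> C * l2_norm (mu \<alpha>) f"
proof (cases n)
  case 0
  then show ?thesis by auto
next
  case (Suc m)
  \<comment> \<open>There is room for \<open>n\<close> balls of radius \<open>\<epsilon>\<close>
    with centres spaced by \<open>3 * \<epsilon>\<close>: the moduli start at
    \<open>\<rho> + \<epsilon>\<close>, leave gaps of at least \<open>\<epsilon>\<close>, and end at
    \<open>\<rho> + 3 * n * \<epsilon> < 1\<close>.\<close>
  define \<epsilon> where "\<epsilon> = (1 - \<rho>) / (3 * real n + 3)"
  have \<epsilon>: "\<epsilon> > 0" "\<epsilon> * (3 * real n + 3) = 1 - \<rho>"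
    using \<rho> by (auto simp: \<epsilon>_def)
  define x where "x = (\<lambda>i::nat. \<rho> + (3 * real i + 2) * \<epsilon>)"
  have modulus: "x i - \<epsilon> \<le> cmod z \<and> cmod z \<le> x i + \<epsilon>" if "z \<in> cball (of_real (x i)) \<epsilon>" for i and z :: complex
  proof -
    have "0 \<le> x i" using \<rho> \<epsilon> by (simp add: x_def)
    moreover have "cmod (complex_of_real (x i) - z) \<le> \<epsilon>" using that by (simp add: dist_norm)
    ultimately show ?thesis
      using norm_triangle_ineq3[of "complex_of_real (x i)" z] by (auto simp: abs_le_iff)
  qed
  have range: "\<rho> + \<epsilon> \<le> x i - \<epsilon>" "i \<le> m \<Longrightarrow> x i + \<epsilon> < 1" for i
  proof -
    show "\<rho> + \<epsilon> \<le> x i - \<epsilon>" using \<epsilon>(1) by (simp add: x_def algebra_simps)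
    assume "i \<le> m"
    then have "(3 * real i + 3) * \<epsilon> \<le> (3 * real n) * \<epsilon>"
      using \<epsilon>(1) Suc by (intro mult_right_mono) auto
    then show "x i + \<epsilon> < 1" using \<epsilon> by (simp add: x_def algebra_simps)
  qed
  have sub: "cball (of_real (x i)) \<epsilon> \<subseteq> unit_disk" if "i \<le> m" for i
    using modulus range(2)[OF that] by fastforce
  define M where "M = (\<lambda>i. measure (mu \<alpha>) (ball (of_real (x i)) \<epsilon>))"
  have M: "M i > 0" if "i \<le> m" for i
    unfolding M_def using \<epsilon>(1) sub[OF that] ball_subset_cball[of "complex_of_real (x i)" \<epsilon>]
    by (intro measure_mu_pos \<alpha>) auto
  define K where "K = (\<Sum>i\<le>m. 1 / sqrt (M i))"
  have K: "1 / sqrt (M i) \<le> K" if "i \<le> m" for i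
    unfolding K_def using that M by (intro member_le_sum) (auto intro: less_imp_le)
  obtain C where C: "C \<ge> 0" "\<And>(t :: nat \<Rightarrow> complex) P k. (\<forall>i\<le>m. cmod (t i) \<le> 1) \<Longrightarrow>
      (\<forall>i j. i < j \<and> j \<le> m \<longrightarrow> \<epsilon>\<^sup>2 \<le> cmod (t i - t j)) \<Longrightarrow> degree P \<le> m \<Longrightarrow>
      cmod (coeff P k) \<le> C * (\<Sum>i\<le>m. cmod (poly P (t i)))"
    using poly_coeff_bound[of "\<epsilon>\<^sup>2" m] \<epsilon>(1) by auto
  have K0: "0 \<le> K" using K[of 0] M[of 0] by (auto intro: order_trans[rotated])
  \<comment> \<open>The factor \<open>n\<close> counts the nodes, \<open>K\<close> bounds values by
    norms, and the power of \<open>\<rho>\<close> undoes the factor \<open>z ^ n\<close> introduced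
    to avoid negative exponents.\<close>
  define C' where "C' = C * (real n * K) / \<rho> ^ n"
  have "cmod (a p q) * \<rho> ^ p \<le> C' * l2_norm (mu \<alpha>) f"
    if a: "coeff_expansion n a f" "f \<in> L2 (mu \<alpha>)" "q < n" for a f p q
  proof -
    define \<xi> where "\<xi> = int p - int q"
    define g where "g = homogeneous_part n a \<xi>"
    have g: "g \<in> L2 (mu \<alpha>)" "continuous_on unit_disk g"
      using homogeneous_part_L2[OF \<alpha>] continuous_on_poly_bergman[OF homogeneous_part_poly_bergman[OF \<alpha>]]
      by (auto simp: g_def)
    \<comment> \<open>Bessel's inequality for a single component; \<open>q < n\<close> places
      \<open>\<xi>\<close> in the index range.\<close>
    have "(l2_norm (mu \<alpha>) g)\<^sup>2 \<le> (l2_norm (mu \<alpha>) f)\<^sup>2"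
      using bessel[OF \<alpha> a(1,2), of "{\<xi>}"] a(3) by (simp add: g_def \<xi>_def)
    then have gf: "l2_norm (mu \<alpha>) g \<le> l2_norm (mu \<alpha>) f"
      by (rule power2_le_imp_le) simp
    have "\<exists>z\<in>cball (of_real (x i)) \<epsilon>. M i * (cmod (g z))\<^sup>2 \<le> (l2_norm (mu \<alpha>) g)\<^sup>2" if "i \<le> m" for i
      unfolding M_def by (rule exists_value_le_l2_norm[OF \<alpha> g \<epsilon>(1) sub[OF that]])
    then obtain z where z: "\<And>i. i \<le> m \<Longrightarrow> z i \<in> cball (of_real (x i)) \<epsilon>"
      "\<And>i. i \<le> m \<Longrightarrow> M i * (cmod (g (z i)))\<^sup>2 \<le> (l2_norm (mu \<alpha>) g)\<^sup>2"
      by metis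
    have gz: "cmod (g (z i)) \<le> K * l2_norm (mu \<alpha>) f" if "i \<le> m" for i
    proof -
      have "sqrt (M i * (cmod (g (z i)))\<^sup>2) \<le> sqrt ((l2_norm (mu \<alpha>) g)\<^sup>2)"
        using z(2)[OF that] by (rule real_sqrt_le_mono)
      then have "sqrt (M i) * cmod (g (z i)) \<le> l2_norm (mu \<alpha>) f"
        using gf by (simp add: real_sqrt_mult)
      then have "cmod (g (z i)) \<le> 1 / sqrt (M i) * l2_norm (mu \<alpha>) f"
        using M[OF that] by (simp add: field_simps)
      also have "\<dots> \<le> K * l2_norm (mu \<alpha>) f"
        by (intro mult_right_mono K that) simp
      finally show ?thesis .
    qed
    obtain R where R: "degree R \<le> n - 1" "coeff R q = a p q"
      "\<And>z. z \<in> unit_disk \<Longrightarrow> z ^ n * g z = z ^ (n + p - q) * poly R (of_real ((cmod z)\<^sup>2))"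
      using homogeneous_part_poly[OF a(3) \<xi>_def, of a] unfolding g_def by blast
    define t where "t = (\<lambda>i. complex_of_real ((cmod (z i))\<^sup>2))"
    have zi: "\<rho> + \<epsilon> \<le> cmod (z i)" "cmod (z i) < 1" if "i \<le> m" for i
      using modulus[OF z(1)[OF that]] range(1)[of i] range(2)[OF that] by auto
    have Rt: "cmod (poly R (t i)) \<le> K * l2_norm (mu \<alpha>) f / \<rho> ^ (n + p)" if "i \<le> m" for i
    proof -
      have "\<rho> ^ (n + p) \<le> cmod (z i) ^ (n + p)"
        using zi[OF that] \<rho> \<epsilon>(1) by (intro power_mono) auto
      \<comment> \<open>Lowering the exponent by \<open>q\<close> increases the power since the
        modulus is below 1; this makes the bound uniform in \<open>q\<close>.\<close>
      also have "\<dots> \<le> cmod (z i) ^ (n + p - q)"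
        using zi[OF that] \<rho> \<epsilon>(1) by (intro power_decreasing) auto
      finally have "\<rho> ^ (n + p) * cmod (poly R (t i)) \<le> cmod (z i) ^ (n + p - q) * cmod (poly R (t i))"
        by (rule mult_right_mono) simp
      also have "\<dots> = cmod (z i) ^ n * cmod (g (z i))"
        using arg_cong[OF R(3)[of "z i"], of cmod] zi[OF that]
        by (simp add: norm_mult norm_power t_def)
      also have "\<dots> \<le> 1 * cmod (g (z i))"
        using zi[OF that] by (intro mult_right_mono power_le_one) auto
      finally have "\<rho> ^ (n + p) * cmod (poly R (t i)) \<le> K * l2_norm (mu \<alpha>) f"
        using gz[OF that] by simp
      then show ?thesis
        using \<rho> by (simp add: pos_le_divide_eq mult.commute)
    qed
    have "cmod (coeff R q) \<le> C * (\<Sum>i\<le>m. cmod (poly R (t i)))"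
    proof (rule C(2))
      show "\<forall>i\<le>m. cmod (t i) \<le> 1"
        using less_imp_le[OF zi(2)] by (auto simp: t_def norm_power intro!: power_le_one)
      show "degree R \<le> m" using R(1) Suc by simp
      \<comment> \<open>Both the difference and the sum of the moduli are at least
        \<open>\<epsilon>\<close>, so their product, the difference of squares, separates the
        nodes.\<close>
      show "\<forall>i j. i < j \<and> j \<le> m \<longrightarrow> \<epsilon>\<^sup>2 \<le> cmod (t i - t j)"
      proof (intro allI impI)
        fix i j assume ij: "i < j \<and> j \<le> m"
        then have im: "i \<le> m" and jm: "j \<le> m" by auto
        have "(3 * real i + 4) * \<epsilon> \<le> (3 * real j + 1) * \<epsilon>"
          using ij \<epsilon>(1) by (intro mult_right_mono) auto
        then have "x i + \<epsilon> + \<epsilon> \<le> x j - \<epsilon>"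
          by (simp add: x_def algebra_simps)
        then have "\<epsilon> \<le> cmod (z j) - cmod (z i)"
          using modulus[OF z(1)[OF im]] modulus[OF z(1)[OF jm]] by simp
        moreover have "\<epsilon> \<le> cmod (z j) + cmod (z i)"
          using zi(1)[OF jm] \<rho> norm_ge_zero[of "z i"] by linarith
        ultimately have "\<epsilon> * \<epsilon> \<le> (cmod (z j) + cmod (z i)) * (cmod (z j) - cmod (z i))"
          using \<epsilon>(1) by (intro mult_mono) auto
        also have "\<dots> = (cmod (z j))\<^sup>2 - (cmod (z i))\<^sup>2"
          by (simp add: power2_eq_square algebra_simps)
        also have "\<dots> \<le> cmod (t i - t j)"
          unfolding t_def of_real_diff[symmetric] norm_of_real by simp
        finally show "\<epsilon>\<^sup>2 \<le> cmod (t i - t j)" by (simp add: power2_eq_square)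
      qed
    qed
    also have "\<dots> \<le> C * (\<Sum>i\<le>m. K * l2_norm (mu \<alpha>) f / \<rho> ^ (n + p))"
      using C(1) Rt by (intro mult_left_mono sum_mono) auto
    also have "\<dots> = C' * l2_norm (mu \<alpha>) f / \<rho> ^ p"
      using Suc by (simp add: C'_def power_add)
    finally show ?thesis
      using \<rho> by (simp add: R(2) pos_le_divide_eq)
  qed
  moreover have "0 \<le> C'" using C(1) K0 \<rho> by (simp add: C'_def)
  ultimately show ?thesis by blast
qed

section \<open>Completeness\<close>

lemma coeff_expansion_diff:
  assumes "coeff_expansion n a f" "coeff_expansion n b g"
  shows "coeff_expansion n (\<lambda>p q. a p q - b p q) (f - g)"
  using coeff_expansion_cmult_add[OF assms, of 1 "-1"] by (simp add: fun_diff_def)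

text \<open>Each of the \<open>n\<close> power series is dominated by a geometric series of ratio
  |z| / \<open>\<rho>\<close>. Applied to differences, this turns uniform weighted coefficient
  bounds into pointwise convergence.\<close>

lemma coeff_expansion_growth:
  assumes "coeff_expansion n a f" "0 < \<rho>" "cmod z < \<rho>" "\<rho> \<le> 1"
    and B: "\<And>p q. q < n \<Longrightarrow> cmod (a p q) * \<rho> ^ p \<le> B"
  shows "cmod (f z) \<le> real n * (B / (1 - cmod z / \<rho>))"
proof -
  have z: "z \<in> unit_disk" using assms(3,4) by simp
  define x where "x = cmod z / \<rho>"
  have x: "0 \<le> x" "x < 1" using assms(2,3) by (auto simp: x_def)
  have "cmod (cnj z ^ q * (\<Sum>p. a p q * z ^ p)) \<le> B / (1 - x)" if "q < n" for q
  proof -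
    have le: "norm (a p q * z ^ p) \<le> B * x ^ p" for p
    proof -
      have "norm (a p q * z ^ p) = (cmod (a p q) * \<rho> ^ p) * x ^ p"
        using assms(2) by (simp add: x_def norm_mult norm_power power_divide)
      also have "\<dots> \<le> B * x ^ p"
        using B[OF that] x by (intro mult_right_mono) auto
      finally show ?thesis .
    qed
    have geo: "(\<lambda>p. B * x ^ p) sums (B * (1 / (1 - x)))"
      using x by (intro sums_mult geometric_sums) auto
    have "norm (\<Sum>p. a p q * z ^ p) \<le> (\<Sum>p. B * x ^ p)"
      using le sums_summable[OF geo] by (rule norm_suminf_le)
    moreover have "cmod (cnj z ^ q) \<le> 1"
      using z by (auto simp: norm_power intro!: power_le_one)
    ultimately have "cmod (cnj z ^ q) * norm (\<Sum>p. a p q * z ^ p) \<le> 1 * (\<Sum>p. B * x ^ p)"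
      by (intro mult_mono) auto
    then show ?thesis
      using sums_unique[OF geo] by (simp add: norm_mult)
  qed
  then have "cmod (\<Sum>q<n. cnj z ^ q * (\<Sum>p. a p q * z ^ p)) \<le> (\<Sum>q<n. B / (1 - x))"
    by (intro sum_norm_le) auto
  with z assms(1) show ?thesis
    by (simp add: coeff_expansion_def x_def)
qed

text \<open>The limit is built from limits of coefficients. Their convergence is part of the
  conclusion so that vanishing coefficients remain zero in the limit.\<close>

lemma l2_Cauchy_coeff_limit:
  assumes \<alpha>: "\<alpha> > -1"
    and X: "\<And>i. X i \<in> L2 (mu \<alpha>)" and A: "\<And>i. coeff_expansion n (A i) (X i)"
    and Cauchy: "\<forall>e>0. \<exists>N. \<forall>i\<ge>N. \<forall>j\<ge>N. l2_norm (mu \<alpha>) (X i - X j) < e"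
  shows "\<exists>b f. coeff_expansion n b f \<and> f \<in> L2 (mu \<alpha>) \<and>
    (\<lambda>k. l2_norm (mu \<alpha>) (X k - f)) \<longlonglongrightarrow> 0 \<and> (\<forall>p q. q < n \<longrightarrow> (\<lambda>i. A i p q) \<longlonglongrightarrow> b p q)"
proof -
  note Cauchy = Cauchy[rule_format]
  have bound: "\<exists>C\<ge>0. \<forall>i j p q. q < n \<longrightarrow>
      cmod (A i p q - A j p q) * \<rho> ^ p \<le> C * l2_norm (mu \<alpha>) (X i - X j)" if \<rho>: "0 < \<rho>" "\<rho> < 1" for \<rho>
  proof -
    obtain C where C: "C \<ge> 0" "\<And>a f p q. coeff_expansion n a f \<Longrightarrow> f \<in> L2 (mu \<alpha>) \<Longrightarrow> q < n \<Longrightarrow>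
        cmod (a p q) * \<rho> ^ p \<le> C * l2_norm (mu \<alpha>) f"
      using coeff_bound[OF \<alpha> \<rho>] by blast
    show ?thesis
      using C(2)[OF coeff_expansion_diff[OF A A] L2_diff[OF X X]] C(1) by blast
  qed
  have "\<exists>l. (\<lambda>i. A i p q) \<longlonglongrightarrow> l" if q: "q < n" for p q
  proof -
    obtain C where C: "C \<ge> 0" "\<And>i j p q. q < n \<Longrightarrow>
        cmod (A i p q - A j p q) * (1/2) ^ p \<le> C * l2_norm (mu \<alpha>) (X i - X j)"
      using bound[of "1/2"] by auto
    have "Cauchy (\<lambda>i. A i p q)"
    proof (rule CauchyI)
      fix e :: real assume "e > 0"
      \<comment> \<open>Dividing by \<open>C + 1\<close> avoids a case distinction when
        \<open>C = 0\<close>.\<close>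
      then have "e * (1/2) ^ p / (C + 1) > 0" using C(1) by simp
      then obtain N where N: "\<And>i j. i \<ge> N \<Longrightarrow> j \<ge> N \<Longrightarrow> l2_norm (mu \<alpha>) (X i - X j) < e * (1/2) ^ p / (C + 1)"
        using Cauchy by meson
      have "cmod (A i p q - A j p q) < e" if "i \<ge> N" "j \<ge> N" for i j
      proof -
        have "cmod (A i p q - A j p q) * (1/2) ^ p \<le> (C + 1) * l2_norm (mu \<alpha>) (X i - X j)"
          using C(2)[OF q, of i p j] l2_norm_nonneg[of "mu \<alpha>" "X i - X j"] by (simp only: distrib_right)
        also have "\<dots> < (C + 1) * (e * (1/2) ^ p / (C + 1))"
          using N[OF that] C(1) by (intro mult_strict_left_mono) auto
        also have "\<dots> = e * (1/2) ^ p" using C(1) by simp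
        finally show ?thesis by simp
      qed
      then show "\<exists>N. \<forall>i\<ge>N. \<forall>j\<ge>N. norm (A i p q - A j p q) < e" by blast
    qed
    then show ?thesis
      by (simp add: Cauchy_convergent_iff convergent_def)
  qed
  then obtain b where b: "\<And>p q. q < n \<Longrightarrow> (\<lambda>i. A i p q) \<longlonglongrightarrow> b p q"
    by metis
  \<comment> \<open>Letting \<open>j\<close> tend to infinity in the estimate of differences keeps
    the bound uniform in \<open>p\<close>.\<close>
  have near: "cmod (A i p q - b p q) * \<rho> ^ p \<le> C * e"
    if C: "C \<ge> 0" "\<And>i j p q. q < n \<Longrightarrow> cmod (A i p q - A j p q) * \<rho> ^ p \<le> C * l2_norm (mu \<alpha>) (X i - X j)"
      and N: "\<And>i j. i \<ge> N \<Longrightarrow> j \<ge> N \<Longrightarrow> l2_norm (mu \<alpha>) (X i - X j) < e" and "i \<ge> N" "q < n"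
    for C \<rho> N e i p q
  proof (rule tendsto_upperbound)
    show "(\<lambda>j. cmod (A i p q - A j p q) * \<rho> ^ p) \<longlonglongrightarrow> cmod (A i p q - b p q) * \<rho> ^ p"
      by (intro tendsto_intros b \<open>q < n\<close>)
    have "cmod (A i p q - A j p q) * \<rho> ^ p \<le> C * e" if "j \<ge> N" for j
      using C(2)[OF \<open>q < n\<close>, of i p j] mult_left_mono[OF less_imp_le[OF N[OF \<open>i \<ge> N\<close> that]] C(1)]
      by linarith
    then show "eventually (\<lambda>j. cmod (A i p q - A j p q) * \<rho> ^ p \<le> C * e) sequentially"
      unfolding eventually_sequentially by blast
  qed simp
  define f where "f = (\<lambda>z. if z \<in> unit_disk then \<Sum>q<n. cnj z ^ q * (\<Sum>p. b p q * z ^ p) else 0)"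
  have fb: "coeff_expansion n b f"
    unfolding coeff_expansion_def
  proof (intro conjI allI impI)
    fix q r assume q: "q < n" and r: "0 \<le> r \<and> r < (1::real)"
    \<comment> \<open>A radius strictly between \<open>r\<close> and 1: the coefficient bound at
      \<open>\<rho>\<close> leaves a convergent geometric series of ratio \<open>r / \<rho>\<close>
      at \<open>r\<close>.\<close>
    define \<rho> where "\<rho> = (r + 1) / 2"
    have \<rho>: "0 < \<rho>" "\<rho> < 1" "r < \<rho>" using r by (auto simp: \<rho>_def)
    obtain C where C: "C \<ge> 0" "\<And>i j p q. q < n \<Longrightarrow>
        cmod (A i p q - A j p q) * \<rho> ^ p \<le> C * l2_norm (mu \<alpha>) (X i - X j)"
      using bound[OF \<rho>(1,2)] by auto
    obtain N where N: "\<And>i j. i \<ge> N \<Longrightarrow> j \<ge> N \<Longrightarrow> l2_norm (mu \<alpha>) (X i - X j) < 1"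
      using Cauchy[of 1] by auto
    show "summable (\<lambda>p. cmod (b p q) * r ^ p)"
    proof (rule summable_comparison_test')
      have "summable (\<lambda>p. C * (r / \<rho>) ^ p)"
        using r \<rho> by (intro summable_mult summable_geometric) auto
      moreover have "summable (\<lambda>p. cmod (A N p q) * r ^ p)"
        using A[of N] q r by (auto simp: coeff_expansion_def)
      ultimately show "summable (\<lambda>p. C * (r / \<rho>) ^ p + cmod (A N p q) * r ^ p)"
        by (rule summable_add)
      fix p
      have "cmod (A N p q - b p q) * \<rho> ^ p \<le> C * 1"
        by (rule near[OF C N]) (use q in auto)
      then have "(cmod (A N p q - b p q) * \<rho> ^ p) * (r / \<rho>) ^ p \<le> C * (r / \<rho>) ^ p"
        using r \<rho> by (intro mult_right_mono) auto
      then have "cmod (A N p q - b p q) * r ^ p \<le> C * (r / \<rho>) ^ p"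
        using \<rho> by (simp add: power_divide)
      moreover have "cmod (b p q) * r ^ p \<le> (cmod (A N p q - b p q) + cmod (A N p q)) * r ^ p"
        using r norm_triangle_sub[of "b p q" "A N p q"]
        by (intro mult_right_mono) (auto simp: norm_minus_commute)
      ultimately show "norm (cmod (b p q) * r ^ p) \<le> C * (r / \<rho>) ^ p + cmod (A N p q) * r ^ p"
        using r by (simp add: algebra_simps)
    qed
  qed (simp add: f_def)
  have lim: "(\<lambda>j. X j z) \<longlonglongrightarrow> f z" if "z \<in> unit_disk" for z
  proof (rule LIMSEQ_I)
    fix e :: real assume "e > 0"
    define \<rho> where "\<rho> = (cmod z + 1) / 2"
    have \<rho>: "0 < \<rho>" "\<rho> < 1" "cmod z < \<rho>"
      using that norm_ge_zero[of z] by (auto simp: \<rho>_def simp del: norm_ge_zero)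
    obtain C where C: "C \<ge> 0" "\<And>i j p q. q < n \<Longrightarrow>
        cmod (A i p q - A j p q) * \<rho> ^ p \<le> C * l2_norm (mu \<alpha>) (X i - X j)"
      using bound[OF \<rho>(1,2)] by auto
    define K where "K = real n * (C / (1 - cmod z / \<rho>))"
    have K: "0 \<le> K" using C(1) \<rho> by (simp add: K_def)
    then have "e / (K + 1) > 0" using \<open>e > 0\<close> by simp
    then obtain N where N: "\<And>i j. i \<ge> N \<Longrightarrow> j \<ge> N \<Longrightarrow> l2_norm (mu \<alpha>) (X i - X j) < e / (K + 1)"
      using Cauchy by meson
    have "norm (X i z - f z) < e" if "i \<ge> N" for i
    proof -
      have "cmod ((X i - f) z) \<le> real n * (C * (e / (K + 1)) / (1 - cmod z / \<rho>))"
        using near[OF C N that] \<rho>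
        by (intro coeff_expansion_growth[OF coeff_expansion_diff[OF A fb]]) auto
      also have "\<dots> = K / (K + 1) * e" by (simp add: K_def mult_ac)
      also have "\<dots> < 1 * e"
        using K \<open>e > 0\<close> by (intro mult_strict_right_mono) auto
      finally show ?thesis by simp
    qed
    then show "\<exists>N. \<forall>i\<ge>N. norm (X i z - f z) < e" by blast
  qed
  \<comment> \<open>Fatou's lemma along \<open>j\<close>, with \<open>X i - f\<close> as the
    pointwise limit of \<open>X i - X j\<close>.\<close>
  have conv: "X i - f \<in> L2 (mu \<alpha>) \<and> (l2_norm (mu \<alpha>) (X i - f))\<^sup>2 \<le> e\<^sup>2"
    if N: "\<And>i j. i \<ge> N \<Longrightarrow> j \<ge> N \<Longrightarrow> l2_norm (mu \<alpha>) (X i - X j) < e" and "i \<ge> N" for i N e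
  proof -
    have ev: "eventually (\<lambda>j. (l2_norm (mu \<alpha>) (X i - X j))\<^sup>2 \<le> e\<^sup>2) sequentially"
      unfolding eventually_sequentially
      using less_imp_le[OF N[OF \<open>i \<ge> N\<close>]] by (auto intro!: exI[of _ N] power_mono)
    have pw: "(\<lambda>j. (X i - X j) z) \<longlonglongrightarrow> (X i - f) z" if "z \<in> space (mu \<alpha>)" for z
      using lim[of z] that by (auto intro!: tendsto_diff)
    show ?thesis
      using l2_norm_pointwise_limit_le[OF L2_diff[OF X X] pw ev] by blast
  qed
  obtain N where "\<And>i j. i \<ge> N \<Longrightarrow> j \<ge> N \<Longrightarrow> l2_norm (mu \<alpha>) (X i - X j) < 1"
    using Cauchy[of 1] by auto
  then have "X N - f \<in> L2 (mu \<alpha>)" using conv by blast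
  \<comment> \<open>Here \<open>f\<close> is recovered as \<open>X N - (X N - f)\<close>.\<close>
  from L2_diff[OF X[of N] this] have fL2: "f \<in> L2 (mu \<alpha>)" by simp
  have "(\<lambda>k. l2_norm (mu \<alpha>) (X k - f)) \<longlonglongrightarrow> 0"
  proof (rule LIMSEQ_I)
    fix e :: real assume "e > 0"
    then obtain N where N: "\<And>i j. i \<ge> N \<Longrightarrow> j \<ge> N \<Longrightarrow> l2_norm (mu \<alpha>) (X i - X j) < e / 2"
      using Cauchy[of "e / 2"] by auto
    have "l2_norm (mu \<alpha>) (X i - f) \<le> e / 2" if "i \<ge> N" for i
      using conv[OF N that] \<open>e > 0\<close> by (auto intro: power2_le_imp_le)
    then show "\<exists>N. \<forall>i\<ge>N. norm (l2_norm (mu \<alpha>) (X i - f) - 0) < e"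
      using \<open>e > 0\<close> by (intro exI[of _ N]) fastforce
  qed
  with fb fL2 b show ?thesis by blast
qed

lemma l2_hilbert_subspace_poly_bergman:
  assumes "\<alpha> > -1"
  shows "l2_hilbert_subspace (mu \<alpha>) (poly_bergman n \<alpha>)"
  unfolding l2_hilbert_subspace_def
proof (intro conjI ballI allI impI)
  show "poly_bergman n \<alpha> \<subseteq> L2 (mu \<alpha>)" by (auto simp: poly_bergman_def)
  show "cfun_subspace (poly_bergman n \<alpha>)" by (rule subspace_poly_bergman)
  show "f = 0" if "f \<in> poly_bergman n \<alpha>" "l2_norm (mu \<alpha>) f = 0" for f
    using poly_bergman_l2_norm_eq_0[OF assms that] .
  fix X :: "nat \<Rightarrow> complex \<Rightarrow> complex"
  assume X: "range X \<subseteq> poly_bergman n \<alpha> \<and>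
    (\<forall>e>0. \<exists>N. \<forall>i\<ge>N. \<forall>j\<ge>N. l2_norm (mu \<alpha>) (X i - X j) < e)"
  then have "\<forall>i. X i \<in> L2 (mu \<alpha>) \<and> (\<exists>a. coeff_expansion n a (X i))"
    using poly_bergman_iff by blast
  then obtain A where A: "\<And>i. X i \<in> L2 (mu \<alpha>)" "\<And>i. coeff_expansion n (A i) (X i)"
    by metis
  obtain b f where "coeff_expansion n b f" "f \<in> L2 (mu \<alpha>)"
    "(\<lambda>k. l2_norm (mu \<alpha>) (X k - f)) \<longlonglongrightarrow> 0"
    using l2_Cauchy_coeff_limit[OF assms A conjunct2[OF X]] by blast
  then show "\<exists>f\<in>poly_bergman n \<alpha>. (\<lambda>k. l2_norm (mu \<alpha>) (X k - f)) \<longlonglongrightarrow> 0"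
    unfolding Bex_def poly_bergman_iff by blast
qed

lemma l2_hilbert_subspace_W_space:
  assumes "\<alpha> > -1"
  shows "l2_hilbert_subspace (mu \<alpha>) (W_space \<xi> (nat (min (int n) (int n + \<xi>))))"
    (is "l2_hilbert_subspace _ ?W")
  unfolding l2_hilbert_subspace_def
proof (intro conjI ballI allI impI)
  have W: "f \<in> L2 (mu \<alpha>)" "f \<in> poly_bergman n \<alpha>" if "f \<in> ?W" for f
    using W_space_subset_poly_bergman[OF assms] that by (auto simp: poly_bergman_def)
  show "?W \<subseteq> L2 (mu \<alpha>)" using W by blast
  show "cfun_subspace ?W" unfolding W_space_def by (rule cfun.subspace_span)
  show "f = 0" if "f \<in> ?W" "l2_norm (mu \<alpha>) f = 0" for f
    using poly_bergman_l2_norm_eq_0[OF assms W(2)[OF that(1)] that(2)] .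
  fix X :: "nat \<Rightarrow> complex \<Rightarrow> complex"
  assume X: "range X \<subseteq> ?W \<and> (\<forall>e>0. \<exists>N. \<forall>i\<ge>N. \<forall>j\<ge>N. l2_norm (mu \<alpha>) (X i - X j) < e)"
  then have "\<forall>i. \<exists>a. coeff_expansion n a (X i) \<and> (\<forall>p q. q < n \<and> int p - int q \<noteq> \<xi> \<longrightarrow> a p q = 0)"
    by (intro allI W_space_imp_coeff_expansion) blast
  then obtain A where A: "\<And>i. coeff_expansion n (A i) (X i)"
    "\<And>i p q. q < n \<Longrightarrow> int p - int q \<noteq> \<xi> \<Longrightarrow> A i p q = 0"
    by metis
  have L2: "X i \<in> L2 (mu \<alpha>)" for i using X W(1) by blast
  obtain b f where bf: "coeff_expansion n b f" "f \<in> L2 (mu \<alpha>)"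
    "(\<lambda>k. l2_norm (mu \<alpha>) (X k - f)) \<longlonglongrightarrow> 0" "\<And>p q. q < n \<Longrightarrow> (\<lambda>i. A i p q) \<longlonglongrightarrow> b p q"
    using l2_Cauchy_coeff_limit[OF assms L2 A(1) conjunct2[OF X]] by blast
  \<comment> \<open>Coefficients off the diagonal are zero along the sequence, hence in the limit,
    which therefore lies in the same space.\<close>
  have "b p q = 0" if "q < n" "int p - int q \<noteq> \<xi>" for p q
    using bf(4)[OF that(1), of p] A(2)[OF that] by (simp add: LIMSEQ_const_iff)
  then have "f = homogeneous_part n b \<xi>"
    by (rule coeff_expansion_homogeneous[OF bf(1)])
  then show "\<exists>f\<in>?W. (\<lambda>k. l2_norm (mu \<alpha>) (X k - f)) \<longlonglongrightarrow> 0"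
    using bf(3) homogeneous_part_in_W_space by blast
qed

text \<open>For \<open>\<xi> \<ge> - n + 1\<close> the integer \<open>min n (n + \<xi>)\<close> is
  at least 1, so \<open>nat\<close> does not truncate it.\<close>

theorem proposition5p5:
  fixes n :: nat and \<alpha> :: real
  assumes "n \<ge> 1" and "\<alpha> > -1"
  shows "orthogonal_hilbert_sum (mu \<alpha>) (poly_bergman n \<alpha>) {- int n + 1..}
    (\<lambda>\<xi>. W_space \<xi> (nat (min (int n) (int n + \<xi>))))"
  unfolding orthogonal_hilbert_sum_def
proof (intro conjI ballI impI)
  let ?W = "\<lambda>\<xi>. W_space \<xi> (nat (min (int n) (int n + \<xi>)))"
  show "l2_hilbert_subspace (mu \<alpha>) (poly_bergman n \<alpha>)"
    using assms(2) by (rule l2_hilbert_subspace_poly_bergman)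
  show W: "?W \<xi> \<subseteq> poly_bergman n \<alpha>" for \<xi>
    using assms(2) by (rule W_space_subset_poly_bergman)
  show "l2_hilbert_subspace (mu \<alpha>) (?W \<xi>)" for \<xi>
    using assms(2) by (rule l2_hilbert_subspace_W_space)
  \<comment> \<open>Different indices are different rotation weights.\<close>
  show "l2_inner (mu \<alpha>) f g = 0" if "f \<in> ?W \<xi>" "g \<in> ?W \<eta>" "\<xi> \<noteq> \<eta>" for f g \<xi> \<eta>
  proof (rule l2_inner_homogeneous_eq_0[OF _ _ _ _ that(3)])
    show "f \<in> borel_measurable (mu \<alpha>)" "g \<in> borel_measurable (mu \<alpha>)"
      using W that(1,2) L2_borel_measurable unfolding poly_bergman_iff subset_iff by blast+
  qed (use that homogeneous_W_space in blast)+
  fix f assume "f \<in> poly_bergman n \<alpha>"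
  then obtain a where "coeff_expansion n a f" "f \<in> L2 (mu \<alpha>)"
    unfolding poly_bergman_iff by blast
  then have "l2_has_sum (mu \<alpha>) (homogeneous_part n a) f {- int n + 1..}"
    by (rule homogeneous_parts_has_sum[OF assms(2)])
  then show "\<exists>g. (\<forall>\<xi>\<in>{- int n + 1..}. g \<xi> \<in> ?W \<xi>) \<and> l2_has_sum (mu \<alpha>) g f {- int n + 1..}"
    using homogeneous_part_in_W_space by blast
qed

end
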